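(* Let the coding system be any one of $\mathsf{K}_1$, $\mathsf{K}_2$, $\mathsf{KV}$. Then $\mathsf{Fin}$ is complete with respect to $\Sigma^0_2$ subobjects of $\omega^\omega$ having the unique witness property; that is, $\mathsf{Fin}$ is a $\Sigma^0_2$ subobject of $\omega^\omega$ having the unique witness property, and every $\Sigma^0_2$ subobject $A$ of $\omega^\omega$ having the unique witness property satisfies $A\leq_{\sf m}\mathsf{Fin}$.
   Context: Coding systems. $\mathsf{K}_1$: $\mathtt{Code}=\omega$, and the (partial) realizable functions are the partial computable functions on $\omega$. $\mathsf{K}_2$: $\mathtt{Code}=\omega^\omega$, and the realizable functions are the partial continuous functions $x\mapsto p\ast x$ ($p\in\omega^\omega$), where $\ast$ is application in Kleene's second algebra. $\mathsf{KV}$: $\mathtt{Code}=\omega^\omega$ with the same application, and the realizable functions are the partial computable ones (those $x\mapsto p\ast x$ with $p$ computable). Fix one of them; $\langle\cdot,\cdot\rangle$ is a standard computable tupling on $\mathtt{Code}$. A represented space $X$ is a set $|X|$ with a partial surjection $\delta_X$ from $\mathtt{Code}$ onto $|X|$; $p$ is an $X$-name of $x$ if $\delta_X(p)=x$. A morphism $f\colon X\to Y$ is a function $|X|\to|Y|$ for which some partial realizable function sends every $X$-name of $x$ to a $Y$-name of $f(x)$. Names of elements of finite products are tuples of names. In $\mathsf{K}_1$, $n\in\omega$ has name $n$, and $\omega^\omega$ consists of the total computable functions, a name being any index; in $\mathsf{K}_2,\mathsf{KV}$, $n\in\omega$ has name $n0^\infty$, and $\omega^\omega$ consists of all functions, each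 named by itself. A subobject $A$ of $X$ is a represented space with $|A|\subseteq|X|$ such that some partial realizable function sends every $A$-name of $x\in|A|$ to an $X$-name of $x$. It is a subspace if moreover $A$-names and $X$-names of each $x\in|A|$ coincide. For subobjects $A,B$ of $X$, $A\subseteq B$ means $|A|\subseteq|B|$ and the inclusion $A\to B$ is a morphism; $A\equiv B$ means $A\subseteq B$ and $B\subseteq A$. Many-one reducibility: for subobjects $A$ of $X$ and $B$ of $Y$, $A\leq_{\sf m}B$ if there are a morphism $\varphi\colon X\to Y$ and partial realizable functions $r_-,r_+$ with: (1) for all $x\in|X|$, $x\in|A|\iff\varphi(x)\in|B|$; (2) if $p$ is an $A$-name of $x\in|A|$ then $r_-(p)$ is a $B$-name of $\varphi(x)$; (3) if $p$ is an $X$-name of $x\in|A|$ and $q$ is a $B$-name of $\varphi(x)$ then $r_+(p,q)$ is an $A$-name of $x$. A uniformly $\Pi^0_1$ sequence of subobjects of $\omega^\omega$ is a sequence $(B_n)_{n\in\omega}$ for which there is a morphism $f\colon\omega\times\omega^\omega\times\omega\to\omega$ such that $B_n$ is (equivalent, uniformly in $n$, to) the subspace $\{x:\forall k\; f(n,x,k)=0\}$. The witnessed union $\biguplus_nB_n$ has underlying set $\bigcup_n|B_n|$, and $\langle u,p\rangle$ is a name of $x$ in it iff $u$ is a name of some $n\in\omega$ and $p$ is a name of $x\in B_n$. A subobject $A$ of $\omega^\omega$ is $\Sigma^0_2$ if $A\equiv\biguplus_nB_n$ for some uniformly $\Pi^0_1$ sequence $(B_n)$. It has the unique witness property if such a sequence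 can be chosen with $|B_n|\cap|B_m|=\emptyset$ whenever $n\neq m$. $\mathsf{Fin}$ is the subobject of $\omega^\omega$ with $|\mathsf{Fin}|=\{x:\exists n\,\forall m\geq n\; x(m)=0\}$; a name of $x\in\mathsf{Fin}$ is a pair $\langle n,p\rangle$ with $p$ an $\omega^\omega$-name of $x$ and $x(m)=0$ for all $m\geq n$. *)

theory Defs
  imports Main "HOL-Library.Nat_Bijection" "HOL-Library.FuncSet" "HOL-Library.Monad_Syntax"
begin

section \<open>Partial computable functions on the natural numbers\<close>

text \<open>
  Programs for the partial recursive functions of one argument, several arguments being
  coded by the Cantor pairing \<^const>\<open>prod_encode\<close>.  The clauses are the initial functions,
  composition, primitive recursion and unbounded minimisation; \<open>PFst\<close>, \<open>PSnd\<close> and \<open>PPair\<close>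
  play the role of the projections and of composition with several inner functions.
\<close>

datatype prog =
    PZero
  | PSucc
  | PFst
  | PSnd
  | PPair prog prog
  | PComp prog prog
  | PPrec prog prog
  | PMu prog

text \<open>
  With \<open>\<langle>a, b\<rangle>\<close> for Cantor pairing, \<open>PPrec f g\<close> satisfies
  \<open>h \<langle>a, 0\<rangle> = f a\<close> and \<open>h \<langle>a, k + 1\<rangle> = g \<langle>a, \<langle>k, h \<langle>a, k\<rangle>\<rangle>\<rangle>\<close>.  \<open>PMu f\<close> sends \<open>a\<close> to the least \<open>k\<close>
  with \<open>f \<langle>a, k\<rangle> = 0\<close>, and is undefined unless \<open>f \<langle>a, j\<rangle>\<close> is defined for every \<open>j < k\<close>.
\<close>

primrec exec :: "prog \<Rightarrow> nat \<Rightarrow> nat option" where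
  "exec PZero n = Some 0"
| "exec PSucc n = Some (Suc n)"
| "exec PFst n = Some (fst (prod_decode n))"
| "exec PSnd n = Some (snd (prod_decode n))"
| "exec (PPair f g) n = do { a \<leftarrow> exec f n; b \<leftarrow> exec g n; Some (prod_encode (a, b)) }"
| "exec (PComp f g) n = do { a \<leftarrow> exec g n; exec f a }"
| "exec (PPrec f g) n =
     (let a = fst (prod_decode n) in
      rec_nat (exec f a)
        (\<lambda>k r. do { v \<leftarrow> r; exec g (prod_encode (a, prod_encode (k, v))) })
        (snd (prod_decode n)))"
| "exec (PMu f) a =
     (if \<exists>k. exec f (prod_encode (a, k)) = Some 0 \<and> (\<forall>j<k. exec f (prod_encode (a, j)) \<noteq> None)
      then Some (LEAST k. exec f (prod_encode (a, k)) = Some 0)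
      else None)"

primrec goedel :: "prog \<Rightarrow> nat" where
  "goedel PZero = 0"
| "goedel PSucc = 1"
| "goedel PFst = 2"
| "goedel PSnd = 3"
| "goedel (PPair f g) = 4 * prod_encode (goedel f, goedel g) + 4"
| "goedel (PComp f g) = 4 * prod_encode (goedel f, goedel g) + 5"
| "goedel (PPrec f g) = 4 * prod_encode (goedel f, goedel g) + 6"
| "goedel (PMu f) = 4 * goedel f + 7"

lemma inj_goedel: "inj goedel"
proof (rule injI)
  fix p q show "goedel p = goedel q \<Longrightarrow> p = q"
  proof (induction p arbitrary: q)
    case PZero then show ?case by (cases q) auto
  next
    case PSucc then show ?case by (cases q) auto
  next
    case PFst then show ?case by (cases q) auto
  next
    case PSnd then show ?case by (cases q) auto
  next
    case (PPair f g) then show ?case by (cases q; simp; (presburger | auto)?)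
  next
    case (PComp f g) then show ?case by (cases q; simp; (presburger | auto)?)
  next
    case (PPrec f g) then show ?case by (cases q; simp; (presburger | auto)?)
  next
    case (PMu f) then show ?case by (cases q; simp; (presburger | auto)?)
  qed
qed

lemma surj_goedel: "surj goedel"
proof -
  have "\<exists>p. goedel p = n" for n
  proof (induction n rule: less_induct)
    case (less n)
    show ?case
    proof (cases "n < 4")
      case True
      then consider "n = 0" | "n = 1" | "n = 2" | "n = 3" by linarith
      then show ?thesis by cases (metis goedel.simps)+
    next
      case False
      define m where "m = (n - 4) div 4"
      obtain a b where ab: "prod_decode m = (a, b)" by fastforce
      have m: "prod_encode (a, b) = m" by (metis ab prod_decode_inverse)
      have "m < n" using False by (simp add: m_def)
      then have "a < n" "b < n"
        using le_prod_encode_1[of a b] le_prod_encode_2[of b a] m by linarith+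
      then obtain f g h where "goedel f = a" "goedel g = b" "goedel h = m"
        using less.IH \<open>m < n\<close> by metis
      then have "goedel (PPair f g) = 4 * m + 4" "goedel (PComp f g) = 4 * m + 5"
        "goedel (PPrec f g) = 4 * m + 6" "goedel (PMu h) = 4 * m + 7"
        using m by simp_all
      moreover have "n = 4 * m + 4 \<or> n = 4 * m + 5 \<or> n = 4 * m + 6 \<or> n = 4 * m + 7"
        using False by (simp add: m_def) presburger
      ultimately show ?thesis by metis
    qed
  qed
  then show ?thesis by (metis surjI)
qed

definition phi :: "nat \<Rightarrow> nat \<Rightarrow> nat option" where
  "phi e = exec (inv goedel e)"

definition computable :: "(nat \<Rightarrow> nat) \<Rightarrow> bool" where
  "computable x \<longleftrightarrow> (\<exists>e. \<forall>n. phi e n = Some (x n))"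


section \<open>Application in Kleene's second algebra\<close>

text \<open>
  \<open>(p \<^bold>* x)(n) = p(n, x(0), \<dots>, x(m-1)) - 1\<close> for the least \<open>m\<close> at which this value of \<open>p\<close> on a
  coded finite sequence is positive; \<open>p \<^bold>* x\<close> is defined iff such an \<open>m\<close> exists for every \<open>n\<close>.
\<close>

definition k2_query :: "(nat \<Rightarrow> nat) \<Rightarrow> (nat \<Rightarrow> nat) \<Rightarrow> nat \<Rightarrow> nat \<Rightarrow> nat" where
  "k2_query p x n m = p (list_encode (n # map x [0..<m]))"

definition k2_app :: "(nat \<Rightarrow> nat) \<Rightarrow> (nat \<Rightarrow> nat) \<Rightarrow> (nat \<Rightarrow> nat) option" where
  "k2_app p x =
     (if \<forall>n. \<exists>m. k2_query p x n m > 0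
      then Some (\<lambda>n. k2_query p x n (LEAST m. k2_query p x n m > 0) - 1)
      else None)"


section \<open>Coding systems\<close>

text \<open>
  A represented space is its partial representation map; its underlying set is the range of
  that map, so surjectivity is built in.
\<close>

type_synonym ('c, 'x) rep_space = "'c \<Rightarrow> 'x option"

definition carrier :: "('c, 'x) rep_space \<Rightarrow> 'x set" where
  "carrier X = ran X"

abbreviation is_name :: "('c, 'x) rep_space \<Rightarrow> 'c \<Rightarrow> 'x \<Rightarrow> bool" where
  "is_name X p x \<equiv> X p = Some x"

record 'c coding_system =
  realizable :: "('c \<Rightarrow> 'c option) set"
  tup :: "'c \<Rightarrow> 'c \<Rightarrow> 'c"
  tup1 :: "'c \<Rightarrow> 'c"
  tup2 :: "'c \<Rightarrow> 'c"
  nat_space :: "('c, nat) rep_space"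
  baire_space :: "('c, nat \<Rightarrow> nat) rep_space"

definition K1 :: "nat coding_system" where
  "K1 = \<lparr> realizable = range phi,
     tup = (\<lambda>a b. prod_encode (a, b)),
     tup1 = (\<lambda>c. fst (prod_decode c)),
     tup2 = (\<lambda>c. snd (prod_decode c)),
     nat_space = Some,
     baire_space = (\<lambda>e. if \<forall>n. phi e n \<noteq> None then Some (\<lambda>n. the (phi e n)) else None) \<rparr>"

definition baire_tup :: "(nat \<Rightarrow> nat) \<Rightarrow> (nat \<Rightarrow> nat) \<Rightarrow> nat \<Rightarrow> nat" where
  "baire_tup p q i = (if even i then p (i div 2) else q (i div 2))"

definition baire_nat_space :: "(nat \<Rightarrow> nat, nat) rep_space" where
  "baire_nat_space p = (if \<forall>i>0. p i = 0 then Some (p 0) else None)"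

definition K2 :: "(nat \<Rightarrow> nat) coding_system" where
  "K2 = \<lparr> realizable = range k2_app,
     tup = baire_tup,
     tup1 = (\<lambda>c i. c (2 * i)),
     tup2 = (\<lambda>c i. c (2 * i + 1)),
     nat_space = baire_nat_space,
     baire_space = Some \<rparr>"

definition KV :: "(nat \<Rightarrow> nat) coding_system" where
  "KV = K2 \<lparr> realizable := k2_app ` {p. computable p} \<rparr>"

text \<open>
  In each system the tupling is a bijection with inverse \<open>tup1, tup2\<close>; hence a space whose names
  are tuples can be described by decoding.
\<close>

lemma tup_bij:
  "tup1 K1 (tup K1 a b) = a" "tup2 K1 (tup K1 a b) = b" "tup K1 (tup1 K1 c) (tup2 K1 c) = c"
  "tup1 K2 (tup K2 p q) = p" "tup2 K2 (tup K2 p q) = q" "tup K2 (tup1 K2 r) (tup2 K2 r) = r"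
  "tup1 KV (tup KV p q) = p" "tup2 KV (tup KV p q) = q" "tup KV (tup1 KV r) (tup2 KV r) = r"
  by (auto simp: K1_def K2_def KV_def baire_tup_def fun_eq_iff elim!: oddE)


section \<open>Represented spaces, morphisms and subobjects\<close>

definition realizes ::
  "('c \<Rightarrow> 'c option) \<Rightarrow> ('c, 'x) rep_space \<Rightarrow> ('c, 'y) rep_space \<Rightarrow> ('x \<Rightarrow> 'y) \<Rightarrow> bool" where
  "realizes F X Y f \<longleftrightarrow>
     (\<forall>p x. is_name X p x \<longrightarrow> (\<exists>q. F p = Some q \<and> is_name Y q (f x)))"

definition morphism ::
  "'c coding_system \<Rightarrow> ('c, 'x) rep_space \<Rightarrow> ('c, 'y) rep_space \<Rightarrow> ('x \<Rightarrow> 'y) \<Rightarrow> bool" where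
  "morphism C X Y f \<longleftrightarrow>
     f \<in> carrier X \<rightarrow> carrier Y \<and> (\<exists>F \<in> realizable C. realizes F X Y f)"

definition prod_space ::
  "'c coding_system \<Rightarrow> ('c, 'x) rep_space \<Rightarrow> ('c, 'y) rep_space \<Rightarrow> ('c, 'x \<times> 'y) rep_space" where
  "prod_space C X Y c = do { x \<leftarrow> X (tup1 C c); y \<leftarrow> Y (tup2 C c); Some (x, y) }"

definition sub_le ::
  "'c coding_system \<Rightarrow> ('c, 'x) rep_space \<Rightarrow> ('c, 'x) rep_space \<Rightarrow> bool" where
  "sub_le C A B \<longleftrightarrow> carrier A \<subseteq> carrier B \<and> morphism C A B (\<lambda>x. x)"

definition sub_equiv ::
  "'c coding_system \<Rightarrow> ('c, 'x) rep_space \<Rightarrow> ('c, 'x) rep_space \<Rightarrow> bool" where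
  "sub_equiv C A B \<longleftrightarrow> sub_le C A B \<and> sub_le C B A"

definition subobject ::
  "'c coding_system \<Rightarrow> ('c, 'x) rep_space \<Rightarrow> ('c, 'x) rep_space \<Rightarrow> bool" where
  "subobject C A X \<longleftrightarrow>
     carrier A \<subseteq> carrier X \<and> (\<exists>F \<in> realizable C. realizes F A X (\<lambda>x. x))"

definition subspace :: "('c, 'x) rep_space \<Rightarrow> 'x set \<Rightarrow> ('c, 'x) rep_space" where
  "subspace X S p = do { x \<leftarrow> X p; if x \<in> S then Some x else None }"

definition many_one ::
  "'c coding_system \<Rightarrow> ('c, 'x) rep_space \<Rightarrow> ('c, 'x) rep_space \<Rightarrow>
   ('c, 'y) rep_space \<Rightarrow> ('c, 'y) rep_space \<Rightarrow> bool" where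
  "many_one C A X B Y \<longleftrightarrow>
     (\<exists>\<phi> r_minus r_plus.
        morphism C X Y \<phi> \<and> r_minus \<in> realizable C \<and> r_plus \<in> realizable C \<and>
        (\<forall>x \<in> carrier X. x \<in> carrier A \<longleftrightarrow> \<phi> x \<in> carrier B) \<and>
        (\<forall>x \<in> carrier A. \<forall>p. is_name A p x \<longrightarrow>
           (\<exists>q. r_minus p = Some q \<and> is_name B q (\<phi> x))) \<and>
        (\<forall>x \<in> carrier A. \<forall>p q. is_name X p x \<and> is_name B q (\<phi> x) \<longrightarrow>
           (\<exists>r. r_plus (tup C p q) = Some r \<and> is_name A r x)))"


section \<open>\<open>\<Sigma>\<^sup>0\<^sub>2\<close> subobjects of Baire space\<close>

text \<open>One realizable function, given a name of \<open>n\<close>, translates \<open>A n\<close>-names into \<open>B n\<close>-names.\<close>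

definition unif_le ::
  "'c coding_system \<Rightarrow> (nat \<Rightarrow> ('c, 'x) rep_space) \<Rightarrow> (nat \<Rightarrow> ('c, 'x) rep_space) \<Rightarrow> bool" where
  "unif_le C A B \<longleftrightarrow>
     (\<exists>F \<in> realizable C. \<forall>u n p x. is_name (nat_space C) u n \<and> is_name (A n) p x \<longrightarrow>
        (\<exists>q. F (tup C u p) = Some q \<and> is_name (B n) q x))"

definition unif_equiv ::
  "'c coding_system \<Rightarrow> (nat \<Rightarrow> ('c, 'x) rep_space) \<Rightarrow> (nat \<Rightarrow> ('c, 'x) rep_space) \<Rightarrow> bool" where
  "unif_equiv C A B \<longleftrightarrow> unif_le C A B \<and> unif_le C B A"

definition unif_Pi01 ::
  "'c coding_system \<Rightarrow> (nat \<Rightarrow> ('c, nat \<Rightarrow> nat) rep_space) \<Rightarrow> bool" where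
  "unif_Pi01 C B \<longleftrightarrow>
     (\<forall>n. subobject C (B n) (baire_space C)) \<and>
     (\<exists>f :: nat \<times> (nat \<Rightarrow> nat) \<times> nat \<Rightarrow> nat.
        morphism C (prod_space C (nat_space C) (prod_space C (baire_space C) (nat_space C)))
          (nat_space C) f \<and>
        unif_equiv C B (\<lambda>n. subspace (baire_space C) {x. \<forall>k. f (n, x, k) = 0}))"

definition witnessed_union ::
  "'c coding_system \<Rightarrow> (nat \<Rightarrow> ('c, 'x) rep_space) \<Rightarrow> ('c, 'x) rep_space" where
  "witnessed_union C B c = do { n \<leftarrow> nat_space C (tup1 C c); B n (tup2 C c) }"

definition Sigma02 :: "'c coding_system \<Rightarrow> ('c, nat \<Rightarrow> nat) rep_space \<Rightarrow> bool" where
  "Sigma02 C A \<longleftrightarrow>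
     subobject C A (baire_space C) \<and>
     (\<exists>B. unif_Pi01 C B \<and> sub_equiv C A (witnessed_union C B))"

definition unique_witness :: "'c coding_system \<Rightarrow> ('c, nat \<Rightarrow> nat) rep_space \<Rightarrow> bool" where
  "unique_witness C A \<longleftrightarrow>
     (\<exists>B. unif_Pi01 C B \<and> sub_equiv C A (witnessed_union C B) \<and>
        (\<forall>n m. n \<noteq> m \<longrightarrow> carrier (B n) \<inter> carrier (B m) = {}))"

definition Fin :: "'c coding_system \<Rightarrow> ('c, nat \<Rightarrow> nat) rep_space" where
  "Fin C c = do {
     n \<leftarrow> nat_space C (tup1 C c);
     x \<leftarrow> baire_space C (tup2 C c);
     if \<forall>m\<ge>n. x m = 0 then Some x else None }"

definition complete_for ::
  "'c coding_system \<Rightarrow> ('c, 'x) rep_space \<Rightarrow> (('c, 'x) rep_space \<Rightarrow> bool) \<Rightarrow>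
   ('c, 'x) rep_space \<Rightarrow> bool" where
  "complete_for C X \<Gamma> B \<longleftrightarrow> \<Gamma> B \<and> (\<forall>A. \<Gamma> A \<longrightarrow> many_one C A X B X)"

end

theory Submission
  imports Defs
begin

text \<open>
  Let \<open>A\<close> be the witnessed union of pairwise disjoint \<open>B\<^sub>n = {x. \<forall>k. f (n, x, k) = 0}\<close>.  At stage \<open>s\<close>
  guess that the witness of \<open>x\<close> is the least \<open>n\<close> that no \<open>k \<le> s\<close> refutes, that is, with
  \<open>f (n, x, k) = 0\<close> for all \<open>k \<le> s\<close>.  A refuted number stays refuted, so the guesses never decrease;
  they converge to the witness if \<open>x \<in> A\<close> and grow without bound otherwise.  The reduction \<open>\<phi>\<close> records
  the stages at which the guess changes, so that \<open>x \<in> A\<close> iff \<open>\<phi> x\<close> is eventually zero.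

  Realizers move the evidence across.  From a bound \<open>N\<close> beyond which \<open>\<phi> x\<close> vanishes, the guess at
  stage \<open>N\<close> is a witness, since it never changes again.  Conversely, given the witness \<open>n\<close>, wait
  for the first stage at which the guess equals \<open>n\<close>: nothing can dislodge it later.  This wait
  ends because \<open>n\<close> is the only witness, so that every smaller number is refuted eventually; without
  uniqueness the limit of the guesses might be a smaller witness than the given one.

  For \<open>Fin\<close> itself, uniqueness is obtained by letting the \<open>n\<close>th piece contain the sequences whose
  least bound is \<open>n\<close>.  A search below any given bound finds the least one.

  All of this uses only a few closure properties of the realizable functions, which are
  collected in the locale \<open>effective_coding\<close>: composition, tupling, computable functions on numbers, evaluation
  of \<open>x \<in> \<omega>\<^sup>\<omega>\<close> at a number, currying, and the search for the first zero of \<open>x\<close>.  The theorem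
  is derived there once (\<open>reduction\<close>, \<open>Fin_complete\<close>).

  It remains to verify these properties in each system.  For \<open>K2\<close> and \<open>KV\<close> they follow
  from a description of application by approximators that answer from a finite prefix of the input;
  the two systems differ only in whether the approximator must be computable, and all
  constructions on approximators are primitive recursive.  For \<open>K1\<close>, currying is the s-m-n theorem and
  evaluation is a universal program, obtained from a stack machine that interprets programs.
\<close>

section \<open>Classes of functions closed under primitive recursion\<close>

abbreviation pfst :: "nat \<Rightarrow> nat" where "pfst n \<equiv> fst (prod_decode n)"
abbreviation psnd :: "nat \<Rightarrow> nat" where "psnd n \<equiv> snd (prod_decode n)"

text \<open>
  The search can never pass \<open>b\<close>, and it returns \<open>b\<close> when nothing below satisfies \<open>P\<close>. In this
  form bounded minimisation is an instance of primitive recursion.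
\<close>

definition search :: "(nat \<Rightarrow> bool) \<Rightarrow> nat \<Rightarrow> nat" where
  "search P b = rec_nat 0 (\<lambda>_ v. if P v then v else Suc v) b"

lemma search_le: "search P b \<le> b"
  by (induction b) (auto simp: search_def)

lemma search_minimal: "j < search P b \<Longrightarrow> \<not> P j"
proof (induction b)
  case (Suc b)
  then show ?case
    by (cases "P (search P b)") (auto simp: search_def less_Suc_eq)
qed (simp add: search_def)

lemma search_found: "search P b < b \<Longrightarrow> P (search P b)"
proof (induction b)
  case (Suc b)
  have step: "search P (Suc b) = (if P (search P b) then search P b else Suc (search P b))"
    by (simp add: search_def)
  show ?case
    using Suc by (cases "P (search P b)") (auto simp: step)
qed simp

lemma search_eqI:
  assumes "P k" and "\<And>j. j < k \<Longrightarrow> \<not> P j" and "k \<le> b"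
  shows "search P b = k"
proof (rule antisym)
  show "search P b \<le> k"
    using search_minimal[of k P b] assms(1) by (meson not_le)
  show "k \<le> search P b"
    using search_found[of P b] assms(2,3) by (metis not_le le_trans)
qed

lemma prod_decode_zero: "prod_decode 0 = (0, 0)"
  using prod_encode_inverse[of "(0, 0)"] by (simp add: prod_encode_def)

text \<open>
  List indexing with a fixed value outside the list: \<open>xs ! i\<close> is unspecified there, and hence
  not known to be primitive recursive.
\<close>

definition nth0 :: "nat list \<Rightarrow> nat \<Rightarrow> nat" where
  "nth0 xs i = (if i < length xs then xs ! i else 0)"

text \<open>
  The class \<open>R\<close> is left open in order to treat two cases at once: all functions, for \<open>K2\<close>, and
  the computable ones, for \<open>KV\<close> and \<open>K1\<close>. Several arguments are coded by pairing, and a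
  predicate belongs to the class through its characteristic function \<open>of_bool\<close>.
\<close>

locale prim_rec_closed =
  fixes R :: "(nat \<Rightarrow> nat) \<Rightarrow> bool"
  assumes zero: "R (\<lambda>_. 0)"
    and Suc: "R Suc"
    and pfst: "R pfst"
    and psnd: "R psnd"
    and pair: "\<And>f g. R f \<Longrightarrow> R g \<Longrightarrow> R (\<lambda>n. prod_encode (f n, g n))"
    and comp: "\<And>f g. R f \<Longrightarrow> R g \<Longrightarrow> R (\<lambda>n. f (g n))"
    and prec: "\<And>f g. R f \<Longrightarrow> R g \<Longrightarrow>
      R (\<lambda>n. rec_nat (f (pfst n)) (\<lambda>k v. g (prod_encode (pfst n, prod_encode (k, v)))) (psnd n))"
begin

lemma R_id: "R (\<lambda>n. n)"
  using pair[OF pfst psnd] by simp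

lemma R_Suc: "R f \<Longrightarrow> R (\<lambda>n. Suc (f n))"
  by (rule comp[OF Suc])

lemma R_pfst: "R f \<Longrightarrow> R (\<lambda>n. pfst (f n))"
  by (rule comp[OF pfst])

lemma R_psnd: "R f \<Longrightarrow> R (\<lambda>n. psnd (f n))"
  by (rule comp[OF psnd])

lemma R_const: "R (\<lambda>_. c)"
  by (induction c) (auto intro: zero R_Suc)

text \<open>
  The shape in which primitive recursion occurs in a term: the step \<open>G\<close> may use the parameter
  \<open>n\<close>, the counter and the previous value, which the premise packs into one argument. All the
  closure rules are stated in this style, so that the membership of an explicit term follows by
  applying them as introduction rules.
\<close>

lemma R_rec:
  assumes "R f" and "R (\<lambda>z. G (pfst z) (pfst (psnd z)) (psnd (psnd z)))" and "R h"
  shows "R (\<lambda>n. rec_nat (f n) (\<lambda>k v. G n k v) (h n))"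
  using comp[OF prec[OF assms(1,2)] pair[OF R_id assms(3)]] by simp

lemmas R_basic = R_id R_const R_Suc R_pfst R_psnd pair R_rec

lemma R_add: assumes "R f" "R g" shows "R (\<lambda>n. f n + g n)"
proof -
  have "rec_nat a (\<lambda>_ v. Suc v) b = a + b" for a b :: nat by (induction b) auto
  moreover have "R (\<lambda>n. rec_nat (f n) (\<lambda>_ v. Suc v) (g n))" by (intro R_basic assms)
  ultimately show ?thesis by simp
qed

lemma R_diff: assumes "R f" "R g" shows "R (\<lambda>n. f n - g n)"
proof -
  have p: "rec_nat 0 (\<lambda>k _. k) b = b - 1" for b :: nat by (cases b) auto
  have d: "rec_nat a (\<lambda>_ v. rec_nat 0 (\<lambda>k _. k) v) b = a - b" for a b :: nat
    by (induction b) (auto simp: p)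
  have "R (\<lambda>n. rec_nat (f n) (\<lambda>_ v. rec_nat 0 (\<lambda>k _. k) v) (g n))" by (intro R_basic assms)
  then show ?thesis by (simp only: d)
qed

lemma R_mult: assumes "R f" "R g" shows "R (\<lambda>n. f n * g n)"
proof -
  have d: "rec_nat 0 (\<lambda>_ v. v + a) b = a * b" for a b :: nat by (induction b) auto
  have "R (\<lambda>n. rec_nat 0 (\<lambda>_ v. v + f n) (g n))"
    by (intro R_basic R_add comp[OF assms(1)] assms)
  then show ?thesis by (simp only: d)
qed

lemma R_is_zero: assumes "R f" shows "R (\<lambda>n. of_bool (f n = 0))"
proof -
  have d: "rec_nat 1 (\<lambda>_ _. 0) b = (of_bool (b = 0) :: nat)" for b by (cases b) auto
  have "R (\<lambda>n. rec_nat 1 (\<lambda>_ _. 0) (f n))" by (intro R_basic assms)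
  then show ?thesis by (simp only: d)
qed

lemma R_le: assumes "R f" "R g" shows "R (\<lambda>n. of_bool (f n \<le> g n))"
  using R_is_zero[OF R_diff[OF assms]] by simp

lemma R_less: assumes "R f" "R g" shows "R (\<lambda>n. of_bool (f n < g n))"
  using R_le[OF R_Suc[OF assms(1)] assms(2)] by (simp add: Suc_le_eq)

lemma R_conj:
  assumes "R (\<lambda>n. of_bool (P n))" "R (\<lambda>n. of_bool (Q n))"
  shows "R (\<lambda>n. of_bool (P n \<and> Q n))"
  using R_mult[OF assms] by (simp add: of_bool_conj)

lemma R_eq: assumes "R f" "R g" shows "R (\<lambda>n. of_bool (f n = g n))"
  using R_conj[OF R_le[OF assms] R_le[OF assms(2,1)]] by (simp add: order_eq_iff)

lemma R_if:
  assumes "R (\<lambda>n. of_bool (P n))" "R f" "R g"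
  shows "R (\<lambda>n. if P n then f n else g n)"
proof -
  have d: "rec_nat b (\<lambda>_ _. a) (of_bool c) = (if c then a else b)" for a b :: nat and c by simp
  have "R (\<lambda>n. rec_nat (g n) (\<lambda>_ _. f n) (of_bool (P n)))"
    by (intro R_basic assms comp[OF assms(2)])
  then show ?thesis by (simp only: d)
qed

lemma R_search:
  assumes "R (\<lambda>z. of_bool (P (pfst z) (psnd z)))" "R b"
  shows "R (\<lambda>n. search (P n) (b n))"
proof -
  have "R (\<lambda>z. of_bool (P (pfst z) (psnd (psnd z))))"
    using comp[OF assms(1), of "\<lambda>z. prod_encode (pfst z, psnd (psnd z))"] by (simp add: R_basic)
  then show ?thesis unfolding search_def by (intro R_basic R_if assms)
qed

lemmas R_arith = R_basic R_add R_diff R_mult R_le R_less R_conj R_eq R_if R_search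

lemma R_div: assumes "R f" "d > 0" shows "R (\<lambda>n. f n div d)"
proof -
  have "search (\<lambda>k. a < d * Suc k) a = a div d" for a
  proof (rule search_eqI)
    show "a < d * Suc (a div d)" using dividend_less_times_div[OF assms(2), of a] by simp
    show "\<not> a < d * Suc j" if "j < a div d" for j
      using that assms(2) by (metis Suc_leI less_eq_div_iff_mult_less_eq mult.commute not_less)
  qed simp
  moreover have "R (\<lambda>n. search (\<lambda>k. f n < d * Suc k) (f n))"
    by (intro R_arith assms comp[OF assms(1)])
  ultimately show ?thesis by simp
qed

lemma R_mod: assumes "R f" "d > 0" shows "R (\<lambda>n. f n mod d)"
proof -
  have "R (\<lambda>n. f n - d * (f n div d))" by (intro R_arith R_div assms)
  then show ?thesis by (simp add: minus_mult_div_eq_mod)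
qed

lemma R_even: assumes "R f" shows "R (\<lambda>n. of_bool (even (f n)))"
proof -
  have "R (\<lambda>n. of_bool (f n mod 2 = 0))" by (intro R_arith R_mod assms) simp
  then show ?thesis by (simp add: even_iff_mod_2_eq_zero)
qed

lemma R_list_decode: "R f \<Longrightarrow> R (\<lambda>n. list_encode (list_decode (f n)))"
  by simp

text \<open>
  Functions that return lists are treated through \<^const>\<open>list_encode\<close>. The code of a nonempty list is
  the successor of a pair, so that the tail is obtained by subtracting one and projecting; the
  empty list has code \<open>0\<close>, and since \<open>0\<close> also codes the pair \<open>(0, 0)\<close>, its tail comes out empty
  again.
\<close>

lemma R_drop:
  assumes "R (\<lambda>n. list_encode (L n))" "R g"
  shows "R (\<lambda>n. list_encode (drop (g n) (L n)))"
proof -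
  have d: "rec_nat (list_encode xs) (\<lambda>_ v. psnd (v - 1)) i = list_encode (drop i xs)" for xs i
  proof (induction i)
    case (Suc i)
    have "psnd (list_encode ys - 1) = list_encode (tl ys)" for ys
      by (cases ys) (auto simp: prod_decode_zero)
    then show ?case using Suc by (simp add: drop_Suc tl_drop)
  qed simp
  have "R (\<lambda>n. rec_nat (list_encode (L n)) (\<lambda>_ v. psnd (v - 1)) (g n))"
    by (intro R_arith assms)
  then show ?thesis by (simp only: d)
qed

lemma R_nth0:
  assumes "R (\<lambda>n. list_encode (L n))" "R g"
  shows "R (\<lambda>n. nth0 (L n) (g n))"
proof -
  have "pfst (list_encode (drop i xs) - 1) = nth0 xs i" for xs i
  proof (cases "i < length xs")
    case True
    then show ?thesis by (simp add: nth0_def flip: Cons_nth_drop_Suc)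
  next
    case False
    then show ?thesis by (simp add: nth0_def prod_decode_zero)
  qed
  moreover have "R (\<lambda>n. pfst (list_encode (drop (g n) (L n)) - 1))"
    by (intro R_arith R_drop assms)
  ultimately show ?thesis by simp
qed

lemma R_length:
  assumes "R (\<lambda>n. list_encode (L n))"
  shows "R (\<lambda>n. length (L n))"
proof -
  have z: "list_encode xs = 0 \<longleftrightarrow> xs = []" for xs by (cases xs) auto
  have l: "length xs \<le> list_encode xs" for xs
  proof (induction xs)
    case (Cons x xs)
    then show ?case using le_prod_encode_2[of "list_encode xs" x] by simp
  qed simp
  have d: "search (\<lambda>i. list_encode (drop i xs) = 0) (list_encode xs) = length xs" for xs
    by (intro search_eqI) (auto simp: z l)
  have a: "R (\<lambda>z. list_encode (L (pfst z)))" using comp[OF assms pfst] .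
  have "R (\<lambda>n. search (\<lambda>i. list_encode (drop i (L n)) = 0) (list_encode (L n)))"
    by (intro R_arith R_drop assms a)
  then show ?thesis by (simp only: d)
qed

text \<open>
  The list is built from its last entry, since \<open>Cons\<close> adds entries at the front.
\<close>

lemma R_map_upt:
  assumes "R (\<lambda>z. G (pfst z) (psnd z))" "R h"
  shows "R (\<lambda>n. list_encode (map (G n) [0..<h n]))"
proof -
  have d: "rec_nat 0 (\<lambda>j v. Suc (prod_encode (g (l - 1 - j), v))) i
      = list_encode (map g [l - i..<l])" if "i \<le> l" for g l i
    using that
  proof (induction i)
    case (Suc i)
    then have "[l - Suc i..<l] = (l - Suc i) # [l - i..<l]"
      by (simp add: Suc_diff_Suc upt_conv_Cons)
    then show ?case using Suc by simp
  qed simp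
  have d': "rec_nat 0 (\<lambda>j v. Suc (prod_encode (g (l - 1 - j), v))) l
      = list_encode (map g [0..<l])" for g l
    using d[of l l g] by simp
  have "R (\<lambda>z. G (pfst z) (h (pfst z) - 1 - pfst (psnd z)))"
    using comp[OF assms(1), of "\<lambda>z. prod_encode (pfst z, h (pfst z) - 1 - pfst (psnd z))"]
    by (simp add: R_arith comp[OF assms(2)])
  then have "R (\<lambda>n. rec_nat 0 (\<lambda>j v. Suc (prod_encode (G n (h n - 1 - j), v))) (h n))"
    by (intro R_arith assms)
  then show ?thesis by (simp only: d')
qed

lemma R_take:
  assumes "R (\<lambda>n. list_encode (L n))" "R g"
  shows "R (\<lambda>n. list_encode (take (g n) (L n)))"
proof -
  have "map (nth0 xs) [0..<if k \<le> length xs then k else length xs] = take k xs" for xs k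
    by (rule nth_equalityI) (auto simp: nth0_def split: if_splits)
  moreover have "R (\<lambda>n. list_encode (map (nth0 (L n))
      [0..<if g n \<le> length (L n) then g n else length (L n)]))"
    by (intro R_map_upt R_nth0 R_arith R_length assms comp[OF assms(1)])
  ultimately show ?thesis by simp
qed

lemmas R_intros = R_arith R_div R_mod R_even R_list_decode R_nth0 R_length R_map_upt R_take

end

lemma computable_iff_prog: "computable f \<longleftrightarrow> (\<exists>P. \<forall>n. exec P n = Some (f n))"
  unfolding computable_def phi_def by (metis inv_f_f[OF inj_goedel])

lemma prim_rec_closed_computable: "prim_rec_closed computable"
proof
  show "computable (\<lambda>_. 0)" unfolding computable_iff_prog by (rule exI[of _ PZero]) simp
  show "computable Suc" unfolding computable_iff_prog by (rule exI[of _ PSucc]) simp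
  show "computable pfst" unfolding computable_iff_prog by (rule exI[of _ PFst]) simp
  show "computable psnd" unfolding computable_iff_prog by (rule exI[of _ PSnd]) simp
next
  fix f g assume "computable f" "computable g"
  then obtain P Q where P: "\<And>n. exec P n = Some (f n)" and Q: "\<And>n. exec Q n = Some (g n)"
    unfolding computable_iff_prog by blast
  show "computable (\<lambda>n. prod_encode (f n, g n))"
    unfolding computable_iff_prog by (rule exI[of _ "PPair P Q"]) (simp add: P Q)
  show "computable (\<lambda>n. f (g n))"
    unfolding computable_iff_prog by (rule exI[of _ "PComp P Q"]) (simp add: P Q)
  have "rec_nat (exec P a) (\<lambda>k r. do { v \<leftarrow> r; exec Q (prod_encode (a, prod_encode (k, v))) }) b
      = Some (rec_nat (f a) (\<lambda>k v. g (prod_encode (a, prod_encode (k, v)))) b)" for a b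
    by (induction b) (auto simp: P Q)
  then show "computable
      (\<lambda>n. rec_nat (f (pfst n)) (\<lambda>k v. g (prod_encode (pfst n, prod_encode (k, v)))) (psnd n))"
    unfolding computable_iff_prog by (intro exI[of _ "PPrec P Q"]) (simp add: Let_def)
qed

interpretation computable: prim_rec_closed computable
  by (rule prim_rec_closed_computable)

section \<open>Guessing the witness\<close>

text \<open>
  Here \<open>P n k\<close> says that \<open>k\<close> does not refute the candidate \<open>n\<close>. The disjunct \<open>n > s\<close> makes the
  guess total: if all candidates up to \<open>s\<close> are refuted, it is \<open>s + 1\<close>, and so it diverges when
  there is no witness.
\<close>

definition guess :: "(nat \<Rightarrow> nat \<Rightarrow> bool) \<Rightarrow> nat \<Rightarrow> nat" where
  "guess P s = (LEAST n. n > s \<or> (\<forall>k\<le>s. P n k))"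

lemma guess_prop: "guess P s > s \<or> (\<forall>k\<le>s. P (guess P s) k)"
  unfolding guess_def by (rule LeastI[of _ "Suc s"]) simp

lemma guess_mono: "s \<le> t \<Longrightarrow> guess P s \<le> guess P t"
  using guess_prop[of t P] unfolding guess_def[of P s] by (intro Least_le) auto

lemma guess_le: "(\<And>k. P n k) \<Longrightarrow> guess P s \<le> n"
  unfolding guess_def by (intro Least_le) auto

text \<open>
  A guess \<open>g\<close> that is final survives arbitrarily late stages \<open>s\<close>. For \<open>s \<ge> g\<close> it is not the
  default value \<open>s + 1\<close>, so no \<open>k \<le> s\<close> refutes it.
\<close>

lemma guess_settled:
  assumes "\<And>s. s \<ge> N \<Longrightarrow> guess P (Suc s) = guess P s"
  shows "P (guess P N) k"
proof -
  have const: "guess P s = guess P N" if "s \<ge> N" for s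
    using that by (induction s rule: dec_induct) (auto simp: assms)
  define s where "s = max N (max k (guess P N))"
  have "s \<ge> N" "k \<le> s" "guess P N \<le> s" by (auto simp: s_def)
  with guess_prop[of s P] const[of s] show ?thesis by auto
qed

text \<open>
  This is where uniqueness of the witness enters: finitely many candidates lie below \<open>n\<close>, and
  each of them has a refutation \<open>r m\<close>, so from some stage on all of them are refuted.
\<close>

lemma guess_reaches:
  assumes all: "\<And>k. P n k" and uniq: "\<And>m. (\<And>k. P m k) \<Longrightarrow> m = n"
  shows "\<exists>s. guess P s = n"
proof -
  have "\<forall>m\<in>{..<n}. \<exists>k. \<not> P m k" using uniq by auto
  then obtain r where r: "\<And>m. m < n \<Longrightarrow> \<not> P m (r m)" by (metis lessThan_iff)
  define s where "s = n + (\<Sum>m<n. r m)"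
  have r_le: "r m \<le> s" if "m < n" for m
    using member_le_sum[of m "{..<n}" r] that by (simp add: s_def)
  have "\<not> guess P s < n"
  proof
    assume less: "guess P s < n"
    then have "\<forall>k\<le>s. P (guess P s) k" using guess_prop[of s P] by (auto simp: s_def)
    with r_le[OF less] r[OF less] show False by blast
  qed
  moreover have "guess P s \<le> n" by (rule guess_le) (rule all)
  ultimately show ?thesis by (intro exI[of _ s]) simp
qed

lemma guess_stays:
  assumes "\<And>k. P n k" "guess P s = n" "s \<le> t"
  shows "guess P t = n"
  using guess_mono[OF assms(3), of P] guess_le[of P n t] assms by (intro antisym) auto

text \<open>
  The disjoint sum of the \<open>B n\<close>: it has the same names as the witnessed union, but keeps the
  index in the point. On it, a uniform translation between sequences of subobjects is an
  ordinary morphism.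
\<close>

definition sum_space ::
  "'c coding_system \<Rightarrow> (nat \<Rightarrow> ('c, 'x) rep_space) \<Rightarrow> ('c, nat \<times> 'x) rep_space" where
  "sum_space C B c = do { n \<leftarrow> nat_space C (tup1 C c); x \<leftarrow> B n (tup2 C c); Some (n, x) }"

lemma prod_space_name [simp]:
  "prod_space C X Y c = Some z \<longleftrightarrow> X (tup1 C c) = Some (fst z) \<and> Y (tup2 C c) = Some (snd z)"
  by (cases z) (auto simp: prod_space_def bind_eq_Some_conv)

lemma sum_space_name [simp]:
  "sum_space C B c = Some z \<longleftrightarrow>
    nat_space C (tup1 C c) = Some (fst z) \<and> B (fst z) (tup2 C c) = Some (snd z)"
  by (cases z) (auto simp: sum_space_def bind_eq_Some_conv)

lemma witnessed_union_name [simp]: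
  "witnessed_union C B c = Some x \<longleftrightarrow>
    (\<exists>n. nat_space C (tup1 C c) = Some n \<and> B n (tup2 C c) = Some x)"
  by (auto simp: witnessed_union_def bind_eq_Some_conv)

lemma subspace_name [simp]: "subspace X S c = Some x \<longleftrightarrow> X c = Some x \<and> x \<in> S"
  by (auto simp: subspace_def bind_eq_Some_conv)

lemma Fin_name [simp]:
  "Fin C c = Some x \<longleftrightarrow> (\<exists>n. nat_space C (tup1 C c) = Some n \<and>
    baire_space C (tup2 C c) = Some x \<and> (\<forall>m\<ge>n. x m = 0))"
  by (auto simp: Fin_def bind_eq_Some_conv)

text \<open>
  The condition on carriers in \<^const>\<open>morphism\<close> is implied by the existence of a realizer, because
  the carrier of a represented space is the range of its naming map.
\<close>

lemma morphism_iff: "morphism C X Y f \<longleftrightarrow> (\<exists>F \<in> realizable C. realizes F X Y f)"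
  unfolding morphism_def realizes_def carrier_def ran_def by blast

lemma morphism_carrier: "morphism C X Y f \<Longrightarrow> x \<in> carrier X \<Longrightarrow> f x \<in> carrier Y"
  unfolding morphism_def by blast

lemma sub_le_iff_morphism: "sub_le C A B \<longleftrightarrow> morphism C A B (\<lambda>x. x)"
  using morphism_carrier[of C A B "\<lambda>x. x"] by (auto simp: sub_le_def)

lemma subobject_iff_morphism: "subobject C A X \<longleftrightarrow> morphism C A X (\<lambda>x. x)"
  using morphism_carrier[of C A X "\<lambda>x. x"] by (auto simp: subobject_def morphism_iff)

text \<open>
  A realizer sees only names. Hence a function of data that a name carries beyond its point
  (such as the bound in a \<open>Fin\<close>-name) can be realized on a space \<open>X\<close> of such richer points and
  then be transported to \<open>X'\<close>, provided that the value depends only on the original point.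
\<close>

lemma morphism_source:
  assumes "morphism C X Y f" and "\<And>c z. X' c = Some z \<Longrightarrow> \<exists>x. X c = Some x \<and> f x = g z"
  shows "morphism C X' Y g"
  using assms unfolding morphism_iff realizes_def by metis

lemma morphism_target:
  assumes "morphism C X Y f"
    and "\<And>c x q. X c = Some x \<Longrightarrow> Y q = Some (f x) \<Longrightarrow> Y' q = Some (g x)"
  shows "morphism C X Y' g"
  using assms unfolding morphism_iff realizes_def by metis

text \<open>
  Realizers are required only to act correctly on the relevant names, so each closure property
  asserts the existence of a realizer that extends the desired partial function. Computable
  functions of two numbers enter through pairing (\<open>op\<close>); the only unbounded search is for the
  first zero of an element of \<open>\<omega>\<^sup>\<omega>\<close> (\<open>least\<close>), and currying extends it to all other searches.
\<close>

locale effective_coding =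
  fixes C :: "'c coding_system"
  assumes tup_inv [simp]: "tup1 C (tup C a b) = a" "tup2 C (tup C a b) = b"
      "tup C (tup1 C c) (tup2 C c) = c"
    and comp_ex: "F \<in> realizable C \<Longrightarrow> G \<in> realizable C \<Longrightarrow>
      \<exists>H \<in> realizable C. \<forall>p q r. G p = Some q \<longrightarrow> F q = Some r \<longrightarrow> H p = Some r"
    and pair_ex: "F \<in> realizable C \<Longrightarrow> G \<in> realizable C \<Longrightarrow>
      \<exists>H \<in> realizable C. \<forall>p q r. F p = Some q \<longrightarrow> G p = Some r \<longrightarrow> H p = Some (tup C q r)"
    and proj1_ex: "\<exists>F \<in> realizable C. \<forall>p. F p = Some (tup1 C p)"
    and proj2_ex: "\<exists>F \<in> realizable C. \<forall>p. F p = Some (tup2 C p)"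
    and const_ex: "\<exists>F \<in> realizable C. \<forall>p. \<exists>q. F p = Some q \<and> is_name (nat_space C) q k"
    and op: "computable h \<Longrightarrow>
      morphism C (prod_space C (nat_space C) (nat_space C)) (nat_space C) (\<lambda>z. h (prod_encode z))"
    and curry_ex: "F \<in> realizable C \<Longrightarrow>
      \<exists>G \<in> realizable C. \<forall>p g.
        (\<forall>u k. is_name (nat_space C) u k \<longrightarrow>
          (\<exists>v. F (tup C p u) = Some v \<and> is_name (nat_space C) v (g k))) \<longrightarrow>
        (\<exists>q. G p = Some q \<and> is_name (baire_space C) q g)"
    and eval: "morphism C (prod_space C (baire_space C) (nat_space C)) (nat_space C) (\<lambda>z. fst z (snd z))"
    and least: "morphism C (subspace (baire_space C) {x. \<exists>k. x k = 0}) (nat_space C) (\<lambda>x. LEAST k. x k = 0)"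
begin

abbreviation N where "N \<equiv> nat_space C"
abbreviation Baire where "Baire \<equiv> baire_space C"
abbreviation times (infixr "\<otimes>" 80) where "X \<otimes> Y \<equiv> prod_space C X Y"

lemma nat_name_ex: "\<exists>u. N u = Some k"
  using const_ex[of k] by blast

lemma morphism_comp:
  assumes "morphism C X Y f" "morphism C Y Z g" shows "morphism C X Z (\<lambda>x. g (f x))"
proof -
  obtain F G where F: "F \<in> realizable C" "realizes F X Y f" and G: "G \<in> realizable C" "realizes G Y Z g"
    using assms unfolding morphism_iff by blast
  then obtain H where "H \<in> realizable C" "\<And>p q r. F p = Some q \<Longrightarrow> G q = Some r \<Longrightarrow> H p = Some r"
    using comp_ex[OF G(1) F(1)] by blast
  then show ?thesis
    using F(2) G(2) unfolding morphism_iff realizes_def by metis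
qed

lemma morphism_pair:
  assumes "morphism C X Y f" "morphism C X Z g" shows "morphism C X (Y \<otimes> Z) (\<lambda>x. (f x, g x))"
proof -
  obtain F G where F: "F \<in> realizable C" "realizes F X Y f" and G: "G \<in> realizable C" "realizes G X Z g"
    using assms unfolding morphism_iff by blast
  then obtain H where "H \<in> realizable C"
      "\<And>p q r. F p = Some q \<Longrightarrow> G p = Some r \<Longrightarrow> H p = Some (tup C q r)"
    using pair_ex[OF F(1) G(1)] by blast
  then show ?thesis
    using F(2) G(2) unfolding morphism_iff realizes_def by (fastforce intro!: bexI[of _ H])
qed

lemma morphism_tup1:
  assumes "\<And>c z. X c = Some z \<Longrightarrow> Y (tup1 C c) = Some (f z)" shows "morphism C X Y f"
  using proj1_ex assms unfolding morphism_iff realizes_def by metis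

lemma morphism_tup2:
  assumes "\<And>c z. X c = Some z \<Longrightarrow> Y (tup2 C c) = Some (f z)" shows "morphism C X Y f"
  using proj2_ex assms unfolding morphism_iff realizes_def by metis

lemma morphism_same_names:
  assumes "\<And>c z. X c = Some z \<Longrightarrow> Y c = Some (f z)" shows "morphism C X Y f"
proof -
  obtain F G where "F \<in> realizable C" "\<And>p. F p = Some (tup1 C p)"
      "G \<in> realizable C" "\<And>p. G p = Some (tup2 C p)"
    using proj1_ex proj2_ex by blast
  with pair_ex[of F G] obtain H where "H \<in> realizable C" "\<And>p. H p = Some p" by fastforce
  with assms show ?thesis unfolding morphism_iff realizes_def by metis
qed

lemma morphism_fst: "morphism C (X \<otimes> Y) X fst" and morphism_snd: "morphism C (X \<otimes> Y) Y snd"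
  by (auto intro: morphism_tup1 morphism_tup2)

lemma morphism_const: "morphism C X N (\<lambda>_. k)"
  using const_ex[of k] unfolding morphism_iff realizes_def by blast

lemma morphism_op:
  assumes "computable (\<lambda>z. h (pfst z) (psnd z))" "morphism C X N f" "morphism C X N g"
  shows "morphism C X N (\<lambda>x. h (f x) (g x))"
  using morphism_comp[OF morphism_pair[OF assms(2,3)] op[OF assms(1)]] by simp

lemma morphism_diff: "morphism C X N f \<Longrightarrow> morphism C X N g \<Longrightarrow> morphism C X N (\<lambda>x. f x - g x)"
  by (rule morphism_op) (intro computable.R_intros)

lemma morphism_le: "morphism C X N f \<Longrightarrow> morphism C X N g \<Longrightarrow> morphism C X N (\<lambda>x. of_bool (f x \<le> g x))"
  by (rule morphism_op) (intro computable.R_intros)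

lemma morphism_less: "morphism C X N f \<Longrightarrow> morphism C X N g \<Longrightarrow> morphism C X N (\<lambda>x. of_bool (f x < g x))"
  by (rule morphism_op) (intro computable.R_intros)

lemma morphism_eq: "morphism C X N f \<Longrightarrow> morphism C X N g \<Longrightarrow> morphism C X N (\<lambda>x. of_bool (f x = g x))"
  by (rule morphism_op) (intro computable.R_intros)

lemma morphism_not:
  assumes "morphism C X N (\<lambda>x. of_bool (P x))" shows "morphism C X N (\<lambda>x. of_bool (\<not> P x))"
  using morphism_eq[OF assms morphism_const[of _ 0]] by simp

lemma morphism_conj:
  assumes "morphism C X N (\<lambda>x. of_bool (P x))" "morphism C X N (\<lambda>x. of_bool (Q x))"
  shows "morphism C X N (\<lambda>x. of_bool (P x \<and> Q x))"
  using morphism_op[OF _ assms, of "(*)"] by (simp add: of_bool_conj computable.R_intros)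

lemma morphism_disj:
  assumes "morphism C X N (\<lambda>x. of_bool (P x))" "morphism C X N (\<lambda>x. of_bool (Q x))"
  shows "morphism C X N (\<lambda>x. of_bool (P x \<or> Q x))"
  using morphism_not[OF morphism_conj[OF assms[THEN morphism_not]]] by simp

lemmas morphism_logic = morphism_const morphism_diff morphism_le morphism_less morphism_eq morphism_not morphism_conj morphism_disj

lemma morphism_eval:
  assumes "morphism C X Baire f" "morphism C X N g" shows "morphism C X N (\<lambda>x. f x (g x))"
  using morphism_comp[OF morphism_pair[OF assms] eval] by simp

lemma morphism_curry:
  assumes "morphism C (X \<otimes> N) N (\<lambda>z. g (fst z) (snd z))" shows "morphism C X Baire g"
proof -
  obtain F where F: "F \<in> realizable C" "realizes F (X \<otimes> N) N (\<lambda>z. g (fst z) (snd z))"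
    using assms unfolding morphism_iff by blast
  obtain G where G: "G \<in> realizable C" "\<And>p g. (\<And>u k. N u = Some k \<Longrightarrow>
      (\<exists>v. F (tup C p u) = Some v \<and> N v = Some (g k))) \<Longrightarrow> (\<exists>q. G p = Some q \<and> Baire q = Some g)"
    using curry_ex[OF F(1)] by metis
  have "realizes G X Baire g"
    unfolding realizes_def using F(2) by (auto intro!: G(2) simp: realizes_def)
  then show ?thesis using G(1) unfolding morphism_iff by blast
qed

text \<open>
  Currying turns the predicate into the sequence of its truth values, with \<open>0\<close> for truth, and
  the search for the first zero does the rest.
\<close>

lemma morphism_Least:
  assumes "morphism C (X \<otimes> N) N (\<lambda>z. of_bool (P (fst z) (snd z)))"
    and "\<And>x. x \<in> carrier X \<Longrightarrow> \<exists>k. P x k"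
  shows "morphism C X N (\<lambda>x. LEAST k. P x k)"
proof -
  have "morphism C X Baire (\<lambda>x k. of_bool (\<not> P x k))" by (rule morphism_curry) (intro morphism_not assms)
  then have "morphism C X (subspace Baire {x. \<exists>k. x k = 0}) (\<lambda>x k. of_bool (\<not> P x k))"
    by (rule morphism_target) (use assms(2) in \<open>auto simp: carrier_def ran_def\<close>)
  from morphism_comp[OF this least] show ?thesis by simp
qed

text \<open>
  Bounded quantification is obtained from search: look for a counterexample, but stop beyond the
  bound, and compare where the search ended with the bound.
\<close>

lemma morphism_bounded_all:
  assumes "morphism C (X \<otimes> N) N (\<lambda>z. of_bool (P (fst z) (snd z)))" "morphism C X N s"
  shows "morphism C X N (\<lambda>x. of_bool (\<forall>k\<le>s x. P x k))"
proof -
  have eq: "s x < (LEAST k. s x < k \<or> \<not> P x k) \<longleftrightarrow> (\<forall>k\<le>s x. P x k)" for x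
    using LeastI[of "\<lambda>k. s x < k \<or> \<not> P x k" "Suc (s x)"]
      not_less_Least[of _ "\<lambda>k. s x < k \<or> \<not> P x k"]
    by (metis le_less_trans lessI not_le)
  have "morphism C X N (\<lambda>x. LEAST k. s x < k \<or> \<not> P x k)"
  proof (rule morphism_Least)
    show "morphism C (X \<otimes> N) N (\<lambda>z. of_bool (s (fst z) < snd z \<or> \<not> P (fst z) (snd z)))"
      by (intro morphism_logic assms morphism_snd morphism_comp[OF morphism_fst assms(2)])
    show "\<exists>k. s x < k \<or> \<not> P x k" for x by blast
  qed
  from morphism_less[OF assms(2) this] show ?thesis by (simp only: eq)
qed

lemma unif_le_morphism:
  assumes "unif_le C A B" shows "morphism C (sum_space C A) (sum_space C B) (\<lambda>z. z)"
proof -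
  obtain F where F: "F \<in> realizable C"
      "\<And>u n p x. N u = Some n \<Longrightarrow> A n p = Some x \<Longrightarrow> \<exists>q. F (tup C u p) = Some q \<and> B n q = Some x"
    using assms unfolding unif_le_def by blast
  obtain G where G: "G \<in> realizable C" "\<And>p. G p = Some (tup1 C p)" using proj1_ex by blast
  obtain H where H: "H \<in> realizable C"
      "\<And>p q r. G p = Some q \<Longrightarrow> F p = Some r \<Longrightarrow> H p = Some (tup C q r)"
    using pair_ex[OF G(1) F(1)] by blast
  have "realizes H (sum_space C A) (sum_space C B) (\<lambda>z. z)"
    unfolding realizes_def
  proof (intro allI impI)
    fix c z assume "sum_space C A c = Some z"
    then have "N (tup1 C c) = Some (fst z)" "A (fst z) (tup2 C c) = Some (snd z)" by simp_all
    from F(2)[OF this] obtain q where "F c = Some q" "B (fst z) q = Some (snd z)" by auto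
    with \<open>N (tup1 C c) = Some (fst z)\<close> H(2)[OF G(2)]
    show "\<exists>q. H c = Some q \<and> sum_space C B q = Some z" by simp
  qed
  then show ?thesis using H(1) unfolding morphism_iff by blast
qed

lemma unif_le_carrier: "unif_le C A B \<Longrightarrow> carrier (A n) \<subseteq> carrier (B n)"
  unfolding unif_le_def carrier_def ran_def using nat_name_ex[of n] by blast

lemma carrier_subspace: "carrier (subspace X S) = carrier X \<inter> S"
  by (auto simp: carrier_def ran_def)

lemma carrier_union: "carrier (witnessed_union C B) = (\<Union>n. carrier (B n))"
proof -
  have "x \<in> carrier (witnessed_union C B)" if "B n p = Some x" for n p x
  proof -
    obtain u where "N u = Some n" using nat_name_ex by blast
    with that have "witnessed_union C B (tup C u p) = Some x" by simp
    then show ?thesis unfolding carrier_def by (rule ranI)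
  qed
  moreover have "\<exists>n. x \<in> carrier (B n)" if "witnessed_union C B c = Some x" for c x
    using that by (auto simp: carrier_def intro: ranI)
  ultimately show ?thesis unfolding carrier_def[of "B _" for B] carrier_def[of "witnessed_union C B"]
    by (auto simp: ran_def carrier_def)
qed

lemma carrier_Fin: "carrier (Fin C) = {x \<in> carrier Baire. \<exists>n. \<forall>m\<ge>n. x m = 0}"
proof -
  have "x \<in> carrier (Fin C)" if "Baire p = Some x" "\<forall>m\<ge>n. x m = 0" for n p x
  proof -
    obtain u where "N u = Some n" using nat_name_ex by blast
    with that have "Fin C (tup C u p) = Some x" by auto
    then show ?thesis unfolding carrier_def by (rule ranI)
  qed
  then show ?thesis by (auto simp: carrier_def ran_def)
qed

text \<open>
  The maps of the reduction are built from morphisms; the values they compute (the witness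
  \<open>w x\<close>, the stage \<open>t x\<close> at which the guess arrives at it) are functions of \<open>x\<close> because the
  witness is unique.
\<close>

theorem reduction:
  assumes "Sigma02 C A" "unique_witness C A"
  shows "many_one C A Baire (Fin C) Baire"
proof -
  obtain B where pi: "unif_Pi01 C B" and eqv: "sub_equiv C A (witnessed_union C B)"
    and disj: "\<And>n m. n \<noteq> m \<Longrightarrow> carrier (B n) \<inter> carrier (B m) = {}"
    using assms(2) unfolding unique_witness_def by blast
  have A_Baire: "morphism C A Baire (\<lambda>x. x)"
    using assms(1) unfolding Sigma02_def subobject_iff_morphism by blast
  have AU: "morphism C A (witnessed_union C B) (\<lambda>x. x)" and UA: "morphism C (witnessed_union C B) A (\<lambda>x. x)"
    using eqv unfolding sub_equiv_def sub_le_iff_morphism by auto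
  obtain f :: "nat \<times> (nat \<Rightarrow> nat) \<times> nat \<Rightarrow> nat"
    where f: "morphism C (N \<otimes> Baire \<otimes> N) N f"
      and ue: "unif_equiv C B (\<lambda>n. subspace Baire {x. \<forall>k. f (n, x, k) = 0})"
    using pi unfolding unif_Pi01_def by blast
  define S where "S n = subspace Baire {x. \<forall>k. f (n, x, k) = 0}" for n
  have BS: "unif_le C B S" and SB: "unif_le C S B"
    using ue unfolding unif_equiv_def S_def by auto
  have carB: "carrier (B n) = {x \<in> carrier Baire. \<forall>k. f (n, x, k) = 0}" for n
    using unif_le_carrier[OF BS, of n] unif_le_carrier[OF SB, of n]
    by (auto simp: S_def carrier_subspace)
  have carA: "carrier A = (\<Union>n. carrier (B n))"
    using morphism_carrier[OF AU] morphism_carrier[OF UA] by (auto simp: carrier_union)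

  define P where "P x n k \<longleftrightarrow> f (n, x, k) = 0" for x n k
  define \<phi> where "\<phi> x s = (of_bool (guess (P x) (Suc s) \<noteq> guess (P x) s) :: nat)" for x s
  \<comment> \<open>Arbitrary \<open>X\<close> and arguments, because these facts are applied in the presence of further
    variables, over which currying and search then range.\<close>
  have P: "morphism C X N (\<lambda>z. of_bool (P (x z) (n z) (k z)))"
    if "morphism C X Baire x" "morphism C X N n" "morphism C X N k"
    for X :: "('c, 'z) rep_space" and x n k
    using morphism_eq[OF morphism_comp[OF morphism_pair[OF that(2) morphism_pair[OF that(1,3)]] f] morphism_const[of _ 0]]
    unfolding P_def by simp
  have guess: "morphism C X N (\<lambda>z. guess (P (x z)) (s z))"
    if "morphism C X Baire x" "morphism C X N s"
    for X :: "('c, 'z) rep_space" and x s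
    unfolding guess_def
  proof (rule morphism_Least)
    have 1: "morphism C (X \<otimes> N) N (\<lambda>z. s (fst z))" using morphism_comp[OF morphism_fst that(2)] .
    have "morphism C ((X \<otimes> N) \<otimes> N) Baire (\<lambda>z. x (fst (fst z)))"
      using morphism_comp[OF morphism_comp[OF morphism_fst morphism_fst] that(1)] .
    then show "morphism C (X \<otimes> N) N
        (\<lambda>z. of_bool (s (fst z) < snd z \<or> (\<forall>k\<le>s (fst z). P (x (fst z)) (snd z) k)))"
      by (intro morphism_logic morphism_bounded_all P 1 morphism_snd morphism_comp[OF morphism_fst morphism_snd])
    show "\<exists>n. s z < n \<or> (\<forall>k\<le>s z. P (x z) n k)" for z by blast
  qed
  have Suc: "morphism C X N (\<lambda>z. Suc (s z))" if "morphism C X N s" for X :: "('c, 'z) rep_space" and s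
    using morphism_op[OF _ that that, of "\<lambda>a _. Suc a"] by (simp add: computable.R_intros)
  have \<phi>: "morphism C Baire Baire \<phi>"
    unfolding \<phi>_def by (rule morphism_curry) (intro morphism_logic guess Suc morphism_fst morphism_snd)

  \<comment> \<open>The pieces are disjoint, so on \<open>A\<close> the description denotes the index of the piece containing \<open>x\<close>.\<close>
  define w where "w x = (THE n. x \<in> carrier (B n))" for x
  have w_eq: "w x = n" if "x \<in> carrier (B n)" for x n
    unfolding w_def using that disj by (intro the_equality) auto
  have w_in: "x \<in> carrier (B (w x))" if "x \<in> carrier A" for x
    using that w_eq by (auto simp: carA)
  have sol: "P x (w x) k" if "x \<in> carrier A" for x k
    using w_in[OF that] by (simp add: carB P_def)
  have reach: "\<exists>s. guess (P x) s = w x" if "x \<in> carrier A" for x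
  proof (rule guess_reaches)
    fix m assume "\<And>k. P x m k"
    then have "x \<in> carrier (B m)" using w_in[OF that] by (simp add: carB P_def)
    then show "m = w x" using w_eq by simp
  qed (rule sol[OF that])
  have settled: "x \<in> carrier A \<and> guess (P x) n = w x"
    if "x \<in> carrier Baire" "\<forall>m\<ge>n. \<phi> x m = 0" for x n
  proof -
    have "P x (guess (P x) n) k" for k
      by (rule guess_settled) (use that(2) in \<open>auto simp: \<phi>_def\<close>)
    then have "x \<in> carrier (B (guess (P x) n))" using that(1) by (simp add: carB P_def)
    then show ?thesis using w_eq by (auto simp: carA)
  qed
  define t where "t x = (LEAST s. guess (P x) s = w x)" for x
  have t_bound: "\<phi> x m = 0" if "x \<in> carrier A" "t x \<le> m" for x m
  proof -
    have "guess (P x) (t x) = w x" unfolding t_def using reach[OF that(1)] by (rule LeastI_ex)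
    then have "guess (P x) i = w x" if "t x \<le> i" for i
      using guess_stays[of "P x" "w x"] sol[OF \<open>x \<in> carrier A\<close>] that by blast
    then show ?thesis using that(2) by (simp add: \<phi>_def)
  qed
  have iff: "x \<in> carrier A \<longleftrightarrow> \<phi> x \<in> carrier (Fin C)" if "x \<in> carrier Baire" for x
    using settled[OF that] t_bound morphism_carrier[OF \<phi> that] by (auto simp: carrier_Fin)

  \<comment> \<open>A name in the witnessed union begins with a name of the witness; then wait for the guess to reach it.\<close>
  have "morphism C (witnessed_union C B) N w"
  proof (rule morphism_tup1)
    fix c x assume "witnessed_union C B c = Some x"
    then obtain n where "N (tup1 C c) = Some n" "x \<in> carrier (B n)"
      by (auto simp: carrier_def ran_def)
    then show "N (tup1 C c) = Some (w x)" using w_eq by simp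
  qed
  from morphism_comp[OF AU this] have w: "morphism C A N w" .
  have "morphism C A N t"
    unfolding t_def
    by (rule morphism_Least) (intro morphism_logic guess morphism_comp[OF morphism_fst A_Baire]
      morphism_snd morphism_comp[OF morphism_fst w] reach)+
  from morphism_pair[OF this morphism_comp[OF A_Baire \<phi>]]
  have forth: "morphism C A (Fin C) \<phi>"
    by (rule morphism_target) (use t_bound in \<open>auto simp: carrier_def ran_def\<close>)

  \<comment> \<open>The inputs of the backward realizer: pairs of a name of \<open>x\<close> and a \<open>Fin\<close>-name of \<open>\<phi> x\<close>.  The bound
    contained in the latter is not determined by \<open>x\<close>, so it is made part of the point.\<close>
  define Z where "Z c = do { x \<leftarrow> Baire (tup1 C c); y \<leftarrow> Fin C (tup2 C c);
    n \<leftarrow> N (tup1 C (tup2 C c)); if x \<in> carrier A \<and> y = \<phi> x then Some (x, n) else None }" for c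
  have Z_name: "Z c = Some z \<longleftrightarrow> Baire (tup1 C c) = Some (fst z) \<and> fst z \<in> carrier A \<and>
      Fin C (tup2 C c) = Some (\<phi> (fst z)) \<and> N (tup1 C (tup2 C c)) = Some (snd z)" for c z
    by (cases z) (auto simp: Z_def bind_eq_Some_conv split: if_splits)
  have Z1: "morphism C Z Baire fst" by (rule morphism_tup1) (simp add: Z_name)
  have "morphism C Z (\<lambda>c. N (tup1 C c)) snd" by (rule morphism_tup2) (simp add: Z_name)
  moreover have "morphism C (\<lambda>c. N (tup1 C c)) N (\<lambda>n. n)" by (rule morphism_tup1)
  ultimately have Z2: "morphism C Z N snd" by (rule morphism_comp)
  have "morphism C Z (N \<otimes> Baire) (\<lambda>z. (guess (P (fst z)) (snd z), fst z))"
    by (intro morphism_pair guess Z1 Z2)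
  then have "morphism C Z (sum_space C S) (\<lambda>z. (guess (P (fst z)) (snd z), fst z))"
  proof (rule morphism_target)
    fix c z q
    assume z: "Z c = Some z" and q: "(N \<otimes> Baire) q = Some (guess (P (fst z)) (snd z), fst z)"
    then have "fst z \<in> carrier Baire" "\<forall>m\<ge>snd z. \<phi> (fst z) m = 0"
      by (auto simp: Z_name carrier_def ran_def)
    then have "guess (P (fst z)) (snd z) = w (fst z)" using settled by blast
    then show "sum_space C S q = Some (guess (P (fst z)) (snd z), fst z)"
      using z q sol[of "fst z"] by (simp add: S_def P_def Z_name)
  qed
  from morphism_comp[OF this unif_le_morphism[OF SB]]
  have "morphism C Z (witnessed_union C B) fst"
    by (rule morphism_target) auto
  from morphism_comp[OF this UA] obtain r where r: "r \<in> realizable C" "realizes r Z A fst"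
    unfolding morphism_iff by blast
  have recover: "\<exists>q'. r (tup C p q) = Some q' \<and> A q' = Some x"
    if "x \<in> carrier A" "Baire p = Some x" "Fin C q = Some (\<phi> x)" for x p q
  proof -
    from that(3) obtain n where "N (tup1 C q) = Some n" by auto
    with that have "Z (tup C p q) = Some (x, n)" by (simp add: Z_name)
    with r(2) show ?thesis unfolding realizes_def by fastforce
  qed
  obtain r' where r': "r' \<in> realizable C" "realizes r' A (Fin C) \<phi>"
    using forth unfolding morphism_iff by blast
  show ?thesis
    unfolding many_one_def
  proof (rule exI[of _ \<phi>], rule exI[of _ r'], rule exI[of _ r], intro conjI ballI allI impI)
    show "x \<in> carrier A \<longleftrightarrow> \<phi> x \<in> carrier (Fin C)" if "x \<in> carrier Baire" for x
      using that by (rule iff)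
    show "\<exists>q. r' p = Some q \<and> Fin C q = Some (\<phi> x)" if "A p = Some x" for p x
      using that r'(2) unfolding realizes_def by blast
    show "\<exists>q'. r (tup C p q) = Some q' \<and> A q' = Some x"
      if "x \<in> carrier A" "Baire p = Some x \<and> Fin C q = Some (\<phi> x)" for x p q
      using that recover by blast
  qed (fact \<phi> r(1) r'(1))+
qed

text \<open>
  The least bound of \<open>x\<close> is \<open>n\<close> iff \<open>x\<close> vanishes from \<open>n\<close> on and \<open>n\<close> cannot be lowered, which is
  decided by the entry at \<open>n - 1\<close>.
\<close>

definition fin_test :: "nat \<times> (nat \<Rightarrow> nat) \<times> nat \<Rightarrow> nat" where
  "fin_test = (\<lambda>(n, x, k). of_bool (n \<le> k \<and> x k \<noteq> 0 \<or> 0 < n \<and> x (n - 1) = 0))"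

definition fin_piece where
  "fin_piece n = subspace Baire {x. \<forall>k. fin_test (n, x, k) = 0}"

lemma fin_test_iff:
  "(\<forall>k. fin_test (n, x, k) = 0) \<longleftrightarrow> (\<forall>m\<ge>n. x m = 0) \<and> (0 < n \<longrightarrow> x (n - 1) \<noteq> 0)"
proof -
  have "fin_test (n, x, k) = 0 \<longleftrightarrow> (n \<le> k \<longrightarrow> x k = 0) \<and> (0 < n \<longrightarrow> x (n - 1) \<noteq> 0)" for k
    unfolding fin_test_def split_conv of_bool_eq_0_iff by argo
  then show ?thesis by (simp only: all_conj_distrib all_simps simp_thms)
qed

lemma unif_Pi01_fin_piece: "unif_Pi01 C fin_piece"
proof -
  have x: "morphism C (N \<otimes> Baire \<otimes> N) Baire (\<lambda>z. fst (snd z))" by (rule morphism_comp[OF morphism_snd morphism_fst])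
  have k: "morphism C (N \<otimes> Baire \<otimes> N) N (\<lambda>z. snd (snd z))" by (rule morphism_comp[OF morphism_snd morphism_snd])
  have "morphism C (N \<otimes> Baire \<otimes> N) N (\<lambda>z. of_bool (fst z \<le> snd (snd z) \<and> fst (snd z) (snd (snd z)) \<noteq> 0
      \<or> 0 < fst z \<and> fst (snd z) (fst z - 1) = 0))"
    by (intro morphism_logic morphism_fst k morphism_eval[OF x])
  then have "morphism C (N \<otimes> Baire \<otimes> N) N fin_test"
    unfolding fin_test_def case_prod_beta .
  moreover have "subobject C (fin_piece n) Baire" for n
    unfolding subobject_iff_morphism by (rule morphism_same_names) (simp add: fin_piece_def)
  moreover have "unif_le C fin_piece fin_piece"
    using proj2_ex unfolding unif_le_def by (metis tup_inv(2))
  ultimately show ?thesis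
    unfolding unif_Pi01_def unif_equiv_def fin_piece_def by blast
qed

lemma disjoint_fin_piece:
  assumes "n \<noteq> m" shows "carrier (fin_piece n) \<inter> carrier (fin_piece m) = {}"
proof -
  have "False" if "n < m" "x \<in> carrier (fin_piece n)" "x \<in> carrier (fin_piece m)" for n m x
    using that by (auto simp: fin_piece_def carrier_subspace fin_test_iff)
  then show ?thesis using assms by (metis disjoint_iff linorder_neqE_nat)
qed

text \<open>
  Only the passage from an arbitrary bound \<open>n\<close> to the least one needs a computation: walk down
  from \<open>n\<close> as long as the entries are zero, where \<open>d\<close> counts the steps.
\<close>

lemma Fin_equiv_union: "sub_equiv C (Fin C) (witnessed_union C fin_piece)"
proof -
  define F where "F = subspace (N \<otimes> Baire) {(n, x). \<forall>m\<ge>n. x m = 0}"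
  define d where "d z = (LEAST d. fst z \<le> d \<or> snd z (fst z - 1 - d) \<noteq> 0)"
    for z :: "nat \<times> (nat \<Rightarrow> nat)"
  have F1: "morphism C F N fst" by (rule morphism_tup1) (auto simp: F_def)
  have F2: "morphism C F Baire snd" by (rule morphism_tup2) (auto simp: F_def)
  have n: "morphism C (F \<otimes> N) N (\<lambda>z. fst (fst z))" by (rule morphism_comp[OF morphism_fst F1])
  have x: "morphism C (F \<otimes> N) Baire (\<lambda>z. snd (fst z))" by (rule morphism_comp[OF morphism_fst F2])
  have "morphism C F N d"
    unfolding d_def by (rule morphism_Least) (intro morphism_logic n morphism_snd morphism_eval[OF x] | blast)+
  then have "morphism C F (N \<otimes> Baire) (\<lambda>z. (fst z - d z, snd z))"
    by (intro morphism_pair morphism_logic F1 F2)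
  then have "morphism C F (witnessed_union C fin_piece) snd"
  proof (rule morphism_target)
    fix c z q assume z: "F c = Some z" and q: "(N \<otimes> Baire) q = Some (fst z - d z, snd z)"
    obtain n x where nx: "z = (n, x)" by (cases z)
    have fin: "x m = 0" if "n \<le> m" for m using z that by (simp add: F_def nx)
    have d1: "n \<le> d z \<or> x (n - 1 - d z) \<noteq> 0"
      using LeastI[of "\<lambda>d. n \<le> d \<or> x (n - 1 - d) \<noteq> 0" n] by (simp add: d_def nx)
    have d2: "x (n - 1 - j) = 0" if "j < d z" for j
      using not_less_Least[of j "\<lambda>d. n \<le> d \<or> x (n - 1 - d) \<noteq> 0"] that by (simp add: d_def nx)
    have "x m = 0" if "n - d z \<le> m" for m
    proof (cases "n \<le> m")
      case False
      then show ?thesis using d2[of "n - 1 - m"] that by (auto simp: le_diff_conv)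
    qed (rule fin)
    with d1 have "\<forall>k. fin_test (n - d z, x, k) = 0"
      by (auto simp: fin_test_iff diff_commute)
    then show "witnessed_union C fin_piece q = Some (snd z)"
      using q by (simp add: nx fin_piece_def)
  qed
  then have "morphism C (Fin C) (witnessed_union C fin_piece) (\<lambda>x. x)"
    by (rule morphism_source) (auto simp: F_def)
  moreover have "morphism C (witnessed_union C fin_piece) (Fin C) (\<lambda>x. x)"
    by (rule morphism_same_names) (auto simp: fin_piece_def fin_test_iff)
  ultimately show ?thesis by (simp add: sub_equiv_def sub_le_iff_morphism)
qed

theorem Fin_complete: "complete_for C Baire (\<lambda>A. Sigma02 C A \<and> unique_witness C A) (Fin C)"
proof -
  have "subobject C (Fin C) Baire"
    unfolding subobject_iff_morphism by (rule morphism_tup2) auto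
  then have "Sigma02 C (Fin C) \<and> unique_witness C (Fin C)"
    unfolding Sigma02_def unique_witness_def
    using unif_Pi01_fin_piece Fin_equiv_union disjoint_fin_piece by blast
  then show ?thesis unfolding complete_for_def using reduction by blast
qed

end

section \<open>Kleene's second algebra\<close>

abbreviation prefix_of :: "(nat \<Rightarrow> nat) \<Rightarrow> nat \<Rightarrow> nat list" where
  "prefix_of x m \<equiv> map x [0..<m]"

text \<open>
  An approximator \<open>a\<close> answers a question \<open>n\<close> about the output from a finite prefix of the input:
  \<open>0\<close> means that the prefix is too short, and \<open>Suc v\<close> that the \<open>n\<close>th entry is \<open>v\<close>. In \<^const>\<open>k2_app\<close>
  only the first positive answer counts, and later ones may contradict it. Here every positive
  answer is required to be correct and answers to be positive from some prefix on, which makes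
  approximators composable.
\<close>

definition approximates :: "(nat \<Rightarrow> nat list \<Rightarrow> nat) \<Rightarrow> (nat \<Rightarrow> nat) \<Rightarrow> (nat \<Rightarrow> nat) \<Rightarrow> bool" where
  "approximates a x y \<longleftrightarrow> (\<forall>n. (\<forall>m. a n (prefix_of x m) \<in> {0, Suc (y n)}) \<and>
     (\<exists>t. \<forall>m\<ge>t. a n (prefix_of x m) = Suc (y n)))"

lemma approximatesI:
  assumes "\<And>n m. a n (prefix_of x m) = (if t n \<le> m then Suc (y n) else 0)"
  shows "approximates a x y"
  using assms unfolding approximates_def by auto

definition nat_name :: "nat \<Rightarrow> nat \<Rightarrow> nat" where
  "nat_name k i = (if i = 0 then k else 0)"

lemma baire_nat_space_iff: "baire_nat_space u = Some k \<longleftrightarrow> u = nat_name k"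
proof
  show "u = nat_name k" if "baire_nat_space u = Some k"
    using that by (auto simp: baire_nat_space_def nat_name_def split: if_splits)
  show "baire_nat_space u = Some k" if "u = nat_name k"
    using that by (auto simp: baire_nat_space_def nat_name_def)
qed

definition K2_over :: "((nat \<Rightarrow> nat) \<Rightarrow> bool) \<Rightarrow> (nat \<Rightarrow> nat) coding_system" where
  "K2_over R = K2 \<lparr> realizable := k2_app ` {p. R p} \<rparr>"

locale kleene_second = prim_rec_closed +
  assumes computable: "\<And>h. computable h \<Longrightarrow> R h"
begin

definition R2 :: "(nat \<Rightarrow> nat list \<Rightarrow> nat) \<Rightarrow> bool" where
  "R2 a \<longleftrightarrow> R (\<lambda>z. a (pfst z) (list_decode (psnd z)))"

lemma R2_app:
  assumes "R2 a" "R f" "R (\<lambda>n. list_encode (L n))" shows "R (\<lambda>n. a (f n) (L n))"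
  using comp[OF assms(1)[unfolded R2_def] pair[OF assms(2,3)]] by simp

text \<open>
  The code \<open>p\<close> of an approximator reads \<open>n\<close> and the prefix off the coded nonempty list that
  \<^const>\<open>k2_app\<close> submits; the first positive answer is correct because all of them are.
\<close>

lemma realizable_if_approximable:
  assumes "R2 a" shows "\<exists>F \<in> k2_app ` {p. R p}. \<forall>x y. approximates a x y \<longrightarrow> F x = Some y"
proof -
  define p where "p c = a (pfst (c - 1)) (list_decode (psnd (c - 1)))" for c
  have "R p" unfolding p_def by (intro R2_app[OF assms] R_intros)
  moreover have "k2_app p x = Some y" if "approximates a x y" for x y
  proof -
    have q: "k2_query p x n m = a n (prefix_of x m)" for n m
      by (simp add: k2_query_def p_def)
    have 1: "\<exists>m. a n (prefix_of x m) > 0" for n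
      using that unfolding approximates_def by (metis order_refl zero_less_Suc)
    have "a n (prefix_of x (LEAST m. a n (prefix_of x m) > 0)) = Suc (y n)" for n
      using LeastI_ex[OF 1[of n]] that unfolding approximates_def by (metis insertE singletonD less_irrefl)
    with 1 show ?thesis by (simp add: k2_app_def q)
  qed
  ultimately show ?thesis by blast
qed

lemma realizable_total:
  assumes "R2 a" "\<And>p. approximates a p (f p)"
  shows "\<exists>F \<in> k2_app ` {p. R p}. \<forall>p. F p = Some (f p)"
  using realizable_if_approximable[OF assms(1)] assms(2) by blast

text \<open>
  Conversely, \<open>p\<close> yields an approximator by replaying the application on the given prefix \<open>\<sigma>\<close>:
  look for the shortest part of \<open>\<sigma>\<close> on which \<open>p\<close> answers, so that only the answer that counts is
  ever given.
\<close>

lemma approximable_if_realizable: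
  assumes "F \<in> k2_app ` {p. R p}"
  shows "\<exists>a. R2 a \<and> (\<forall>x y. F x = Some y \<longrightarrow> approximates a x y)"
proof -
  obtain p where p: "R p" "F = k2_app p" using assms by blast
  define a where "a n \<sigma> = p (Suc (prod_encode (n, list_encode
      (take (search (\<lambda>m. 0 < p (Suc (prod_encode (n, list_encode (take m \<sigma>))))) (length \<sigma>)) \<sigma>))))"
    for n \<sigma>
  have "R2 a"
    unfolding R2_def a_def by (intro comp[OF p(1)] R_intros)
  moreover have "approximates a x y" if "F x = Some y" for x y
  proof -
    have ex: "\<exists>m. k2_query p x n m > 0" for n
      using that p(2) by (auto simp: k2_app_def split: if_splits)
    define t where "t n = (LEAST m. k2_query p x n m > 0)" for n
    have t: "k2_query p x n (t n) = Suc (y n)" for n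
      using that p(2) ex LeastI_ex[OF ex[of n]] by (auto simp: k2_app_def t_def)
    have below: "k2_query p x n m = 0" if "m < t n" for n m
      using not_less_Least[of m "\<lambda>m. k2_query p x n m > 0"] that by (simp add: t_def)
    have q: "p (Suc (prod_encode (n, list_encode (take j (prefix_of x m))))) = k2_query p x n j"
      if "j \<le> m" for n j m
      using that by (simp add: k2_query_def take_map take_upt)
    have "a n (prefix_of x m) = (if t n \<le> m then Suc (y n) else 0)" for n m
    proof -
      let ?P = "\<lambda>j. 0 < p (Suc (prod_encode (n, list_encode (take j (prefix_of x m)))))"
      have a: "a n (prefix_of x m) = k2_query p x n (search ?P m)"
        using q[OF search_le[of ?P m]] by (simp add: a_def)
      show ?thesis
      proof (cases "t n \<le> m")
        case True
        have "search ?P m = t n"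
          using True t below by (intro search_eqI) (auto simp: q)
        then show ?thesis using True t by (simp add: a)
      next
        case False
        then show ?thesis using below search_le[of ?P m] by (simp add: a)
      qed
    qed
    then show ?thesis by (rule approximatesI)
  qed
  ultimately show ?thesis by blast
qed

text \<open>
  From a prefix of the input, \<open>a\<close> determines an initial segment of the intermediate result, cut
  off at the first entry on which it is silent, and \<open>b\<close> is run on this segment. The segment
  grows beyond all bounds with the prefix.
\<close>

lemma approximates_comp:
  assumes q: "approximates a p q" and r: "approximates b q r"
  shows "approximates (\<lambda>n \<sigma>. b n (map (\<lambda>i. a i \<sigma> - 1) [0..<search (\<lambda>i. a i \<sigma> = 0) (length \<sigma>)])) p r"
proof -
  define l where "l m = search (\<lambda>i. a i (prefix_of p m) = 0) m" for m
  have "a i (prefix_of p m) = Suc (q i)" if "i < l m" for i m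
    using search_minimal[of i "\<lambda>i. a i (prefix_of p m) = 0" m] that q
    unfolding l_def approximates_def by (metis insertE singletonD)
  then have pre: "map (\<lambda>i. a i (prefix_of p m) - 1)
      [0..<search (\<lambda>i. a i (prefix_of p m) = 0) (length (prefix_of p m))] = prefix_of q (l m)" for m
    by (auto simp: l_def)
  have grows: "\<exists>t. \<forall>m\<ge>t. l m \<ge> s" for s
  proof -
    obtain t where t: "\<And>i m. m \<ge> t i \<Longrightarrow> a i (prefix_of p m) = Suc (q i)"
      using q unfolding approximates_def by metis
    have "l m \<ge> s" if "m \<ge> s + (\<Sum>i<s. t i)" for m
    proof (rule ccontr)
      assume "\<not> s \<le> l m"
      then have less: "l m < s" by simp
      then have "a (l m) (prefix_of p m) = 0"
        using search_found[of "\<lambda>i. a i (prefix_of p m) = 0" m] that unfolding l_def by simp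
      moreover have "t (l m) \<le> m" using member_le_sum[of "l m" "{..<s}" t] less that by simp
      ultimately show False using t by simp
    qed
    then show ?thesis by blast
  qed
  show ?thesis
    unfolding approximates_def pre
  proof (intro allI conjI)
    fix n
    show "b n (prefix_of q (l m)) \<in> {0, Suc (r n)}" for m
      using r unfolding approximates_def by blast
    obtain s where s: "\<forall>m\<ge>s. b n (prefix_of q m) = Suc (r n)"
      using r unfolding approximates_def by blast
    obtain t where "\<forall>m\<ge>t. l m \<ge> s" using grows by blast
    with s show "\<exists>t. \<forall>m\<ge>t. b n (prefix_of q (l m)) = Suc (r n)" by blast
  qed
qed

text \<open>
  Each operation is given by an explicit approximator. Those with a number as output only have
  to find the entry at \<open>0\<close>; the later entries of the name of a number are \<open>0\<close>, that is, the
  answer is \<open>1\<close>.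
\<close>

lemma effective_K2_over: "effective_coding (K2_over R)"
proof
  let ?C = "K2_over R" and ?RZ = "k2_app ` {p. R p}"
  have C: "realizable ?C = ?RZ" "tup ?C = baire_tup" "tup1 ?C = (\<lambda>c i. c (2 * i))"
    "tup2 ?C = (\<lambda>c i. c (2 * i + 1))" "nat_space ?C = baire_nat_space" "baire_space ?C = Some"
    by (simp_all add: K2_over_def K2_def)

  show "tup1 ?C (tup ?C a b) = a" "tup2 ?C (tup ?C a b) = b" "tup ?C (tup1 ?C c) (tup2 ?C c) = c"
    for a b c using tup_bij(4-6) by (simp_all add: K2_over_def)

  have realize: "morphism ?C X Y f"
    if "R2 a" "\<And>p x. X p = Some x \<Longrightarrow> \<exists>q. approximates a p q \<and> Y q = Some (f x)"
    for a and X :: "(nat \<Rightarrow> nat, 'x) rep_space" and Y :: "(nat \<Rightarrow> nat, 'y) rep_space" and f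
    using realizable_if_approximable[OF that(1)] that(2) unfolding morphism_iff realizes_def C by metis

  show "\<exists>H\<in>realizable ?C. \<forall>p q r. G p = Some q \<longrightarrow> F q = Some r \<longrightarrow> H p = Some r"
    if FG: "F \<in> realizable ?C" "G \<in> realizable ?C" for F G
  proof -
    obtain a where a: "R2 a" "\<And>x y. G x = Some y \<Longrightarrow> approximates a x y"
      using approximable_if_realizable FG(2) unfolding C by blast
    obtain b where b: "R2 b" "\<And>x y. F x = Some y \<Longrightarrow> approximates b x y"
      using approximable_if_realizable FG(1) unfolding C by blast
    have "R2 (\<lambda>n \<sigma>. b n (map (\<lambda>i. a i \<sigma> - 1) [0..<search (\<lambda>i. a i \<sigma> = 0) (length \<sigma>)]))"
      unfolding R2_def by (intro R2_app[OF b(1)] R2_app[OF a(1)] R_intros)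
    from realizable_if_approximable[OF this] show ?thesis
      using approximates_comp[OF a(2) b(2)] unfolding C by blast
  qed

  show "\<exists>H\<in>realizable ?C. \<forall>p q r. F p = Some q \<longrightarrow> G p = Some r \<longrightarrow> H p = Some (tup ?C q r)"
    if FG: "F \<in> realizable ?C" "G \<in> realizable ?C" for F G
  proof -
    obtain a where a: "R2 a" "\<And>x y. F x = Some y \<Longrightarrow> approximates a x y"
      using approximable_if_realizable FG(1) unfolding C by blast
    obtain b where b: "R2 b" "\<And>x y. G x = Some y \<Longrightarrow> approximates b x y"
      using approximable_if_realizable FG(2) unfolding C by blast
    define c where "c n \<sigma> = (if even n then a (n div 2) \<sigma> else b (n div 2) \<sigma>)" for n \<sigma>
    have "R2 c"
      unfolding R2_def c_def by (intro R2_app[OF a(1)] R2_app[OF b(1)] R_intros) simp_all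
    from realizable_if_approximable[OF this] obtain H
      where "H \<in> ?RZ" "\<And>p y. approximates c p y \<Longrightarrow> H p = Some y" by blast
    moreover have "approximates c p (baire_tup q r)" if "F p = Some q" "G p = Some r" for p q r
      using a(2)[OF that(1)] b(2)[OF that(2)] unfolding approximates_def baire_tup_def c_def by simp
    ultimately show ?thesis unfolding C by blast
  qed

  have entry: "\<exists>F\<in>?RZ. \<forall>p. F p = Some (\<lambda>n. p (2 * n + e))" for e
  proof -
    let ?a = "\<lambda>n \<sigma>. if 2 * n + e < length \<sigma> then Suc (nth0 \<sigma> (2 * n + e)) else 0"
    have "R2 ?a" unfolding R2_def by (intro R_intros)
    moreover have "approximates ?a p (\<lambda>n. p (2 * n + e))" for p
      by (rule approximatesI[of _ _ "\<lambda>n. Suc (2 * n + e)"]) (simp add: nth0_def Suc_le_eq)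
    ultimately show ?thesis by (rule realizable_total)
  qed
  show "\<exists>F\<in>realizable ?C. \<forall>p. F p = Some (tup1 ?C p)"
    using entry[of 0] by (simp add: C)
  show "\<exists>F\<in>realizable ?C. \<forall>p. F p = Some (tup2 ?C p)"
    using entry[of 1] by (simp add: C)

  show "\<exists>F\<in>realizable ?C. \<forall>p. \<exists>q. F p = Some q \<and> nat_space ?C q = Some k" for k
  proof -
    have "R2 (\<lambda>n \<sigma>. Suc (if n = 0 then k else 0))" unfolding R2_def by (intro R_intros)
    moreover have "approximates (\<lambda>n \<sigma>. Suc (if n = 0 then k else 0)) p (nat_name k)" for p
      by (rule approximatesI[of _ _ "\<lambda>_. 0"]) (simp add: nat_name_def)
    ultimately show ?thesis
      using realizable_total[of _ "\<lambda>_. nat_name k"] unfolding C baire_nat_space_iff by blast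
  qed

  show "morphism ?C (prod_space ?C (nat_space ?C) (nat_space ?C)) (nat_space ?C) (\<lambda>z. h (prod_encode z))"
    if "computable h" for h
  proof (rule realize)
    let ?a = "\<lambda>n \<sigma>. if n = 0
      then (if 1 < length \<sigma> then Suc (h (prod_encode (nth0 \<sigma> 0, nth0 \<sigma> 1))) else 0) else 1"
    show "R2 ?a" unfolding R2_def by (intro comp[OF computable[OF that]] R_intros)
    fix p z assume "prod_space ?C (nat_space ?C) (nat_space ?C) p = Some z"
    then obtain k l where z: "z = (k, l)" and "baire_nat_space (\<lambda>i. p (2 * i)) = Some k"
        "baire_nat_space (\<lambda>i. p (2 * i + 1)) = Some l"
      by (cases z) (auto simp: C)
    then have "p 0 = k" "p 1 = l" by (auto simp: baire_nat_space_def split: if_splits)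
    then have "approximates ?a p (nat_name (h (prod_encode z)))"
      by (intro approximatesI[of _ _ "\<lambda>n. if n = 0 then 2 else 0"])
        (auto simp: nat_name_def nth0_def z)
    then show "\<exists>q. approximates ?a p q \<and> nat_space ?C q = Some (h (prod_encode z))"
      unfolding C baire_nat_space_iff by blast
  qed

  show "\<exists>G\<in>realizable ?C. \<forall>p g.
      (\<forall>u k. nat_space ?C u = Some k \<longrightarrow>
        (\<exists>v. F (tup ?C p u) = Some v \<and> nat_space ?C v = Some (g k))) \<longrightarrow>
      (\<exists>q. G p = Some q \<and> baire_space ?C q = Some g)"
    if F: "F \<in> realizable ?C" for F
  proof -
    obtain a where a: "R2 a" "\<And>x y. F x = Some y \<Longrightarrow> approximates a x y"
      using approximable_if_realizable F unfolding C by blast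
    \<comment> \<open>The list is the prefix, of twice the length, of the tuple of the input with the name of \<open>k\<close>.\<close>
    define b where "b k \<sigma> = a 0 (map (\<lambda>i. if even i then nth0 \<sigma> (i div 2) else if i = 1 then k else 0)
      [0..<2 * length \<sigma>])" for k \<sigma>
    have "R2 b" unfolding R2_def b_def by (intro R2_app[OF a(1)] R_intros) simp_all
    moreover have "approximates b p g" if "\<And>k. F (baire_tup p (nat_name k)) = Some (nat_name (g k))" for p g
    proof -
      have pre: "map (\<lambda>i. if even i then nth0 (prefix_of p m) (i div 2) else if i = 1 then k else 0)
          [0..<2 * m] = prefix_of (baire_tup p (nat_name k)) (2 * m)" for k m
        by (auto simp: baire_tup_def nat_name_def nth0_def elim!: oddE)
      have b: "b k (prefix_of p m) = a 0 (prefix_of (baire_tup p (nat_name k)) (2 * m))" for k m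
        by (simp only: b_def length_map length_upt diff_zero pre)
      have *: "(\<forall>m. a 0 (prefix_of (baire_tup p (nat_name k)) m) \<in> {0, Suc (g k)}) \<and>
          (\<exists>t. \<forall>m\<ge>t. a 0 (prefix_of (baire_tup p (nat_name k)) m) = Suc (g k))" for k
        using spec[OF a(2)[OF that[of k], unfolded approximates_def], of 0] by (simp add: nat_name_def)
      show ?thesis
        unfolding approximates_def b
      proof (intro allI conjI)
        fix k
        show "a 0 (prefix_of (baire_tup p (nat_name k)) (2 * m)) \<in> {0, Suc (g k)}" for m
          using * by blast
        obtain t where "\<forall>m\<ge>t. a 0 (prefix_of (baire_tup p (nat_name k)) m) = Suc (g k)" using * by blast
        then show "\<exists>t. \<forall>m\<ge>t. a 0 (prefix_of (baire_tup p (nat_name k)) (2 * m)) = Suc (g k)"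
          by (intro exI[of _ t]) simp
      qed
    qed
    ultimately show ?thesis
      using realizable_if_approximable[of b] unfolding C baire_nat_space_iff by auto
  qed

  show "morphism ?C (prod_space ?C (baire_space ?C) (nat_space ?C)) (nat_space ?C) (\<lambda>z. fst z (snd z))"
  proof (rule realize)
    let ?a = "\<lambda>n \<sigma>. if n = 0
      then (if 1 < length \<sigma> \<and> 2 * nth0 \<sigma> 1 < length \<sigma> then Suc (nth0 \<sigma> (2 * nth0 \<sigma> 1)) else 0) else 1"
    show "R2 ?a" unfolding R2_def by (intro R_intros)
    fix p z assume "prod_space ?C (baire_space ?C) (nat_space ?C) p = Some z"
    then obtain x k where z: "z = (x, k)" and "(\<lambda>i. p (2 * i)) = x"
        "baire_nat_space (\<lambda>i. p (2 * i + 1)) = Some k"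
      by (cases z) (auto simp: C)
    then have "\<And>i. p (2 * i) = x i" "p 1 = k" by (auto simp: baire_nat_space_def split: if_splits)
    then have "approximates ?a p (nat_name (fst z (snd z)))"
      by (intro approximatesI[of _ _ "\<lambda>n. if n = 0 then max 2 (Suc (2 * k)) else 0"])
        (auto simp: nat_name_def nth0_def z)
    then show "\<exists>q. approximates ?a p q \<and> nat_space ?C q = Some (fst z (snd z))"
      unfolding C baire_nat_space_iff by blast
  qed

  show "morphism ?C (subspace (baire_space ?C) {x. \<exists>k. x k = 0}) (nat_space ?C) (\<lambda>x. LEAST k. x k = 0)"
  proof (rule realize)
    let ?s = "\<lambda>\<sigma>. search (\<lambda>k. nth0 \<sigma> k = 0) (length \<sigma>)"
    let ?a = "\<lambda>n \<sigma>. if n = 0 then (if ?s \<sigma> < length \<sigma> then Suc (?s \<sigma>) else 0) else 1"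
    show "R2 ?a" unfolding R2_def by (intro R_intros)
    fix p x assume "subspace (baire_space ?C) {x. \<exists>k. x k = 0} p = Some x"
    then have p: "p = x" and ex: "\<exists>k. x k = 0"
      by (auto simp: C)
    define k where "k = (LEAST k. x k = 0)"
    have k: "x k = 0" "\<And>j. j < k \<Longrightarrow> x j \<noteq> 0"
      using LeastI_ex[OF ex] not_less_Least unfolding k_def by auto
    have "?s (prefix_of x m) = (if k < m then k else m)" for m
      by (rule search_eqI) (use k in \<open>auto simp: nth0_def split: if_splits\<close>)
    then have "approximates ?a p (nat_name k)"
      by (intro approximatesI[of _ _ "\<lambda>n. if n = 0 then Suc k else 0"])
        (auto simp: nat_name_def p)
    then show "\<exists>q. approximates ?a p q \<and> nat_space ?C q = Some (LEAST k. x k = 0)"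
      unfolding C baire_nat_space_iff k_def by blast
  qed
qed

end

lemma effective_K2: "effective_coding K2"
proof -
  have "kleene_second (\<lambda>_. True)" by unfold_locales simp_all
  moreover have "K2_over (\<lambda>_. True) = K2" by (simp add: K2_over_def K2_def)
  ultimately show ?thesis using kleene_second.effective_K2_over by fastforce
qed

lemma effective_KV: "effective_coding KV"
proof -
  have "kleene_second computable" by unfold_locales
  moreover have "K2_over computable = KV" by (simp add: K2_over_def KV_def)
  ultimately show ?thesis using kleene_second.effective_K2_over by fastforce
qed

section \<open>Kleene's first algebra\<close>

text \<open>
  Universality is proved with a machine that interprets programs. A state is a pair of a stack
  and a current value; the stack is \<open>0\<close> or a topmost frame pushed onto a stack. A frame with tag
  \<open>0\<close> asks for the program with code \<open>x\<close> to be run on the current value, which is then replaced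
  by the result. The other frames are continuations that wait for such a result: of the first
  (\<open>1\<close>) or second (\<open>2\<close>) component of a pair, of a stage of a primitive recursion (\<open>3\<close>), or of a
  test in a minimisation (\<open>4\<close>).
\<close>

definition push :: "nat \<Rightarrow> nat \<Rightarrow> nat" where
  "push F T = Suc (prod_encode (F, T))"

definition frame :: "nat \<Rightarrow> nat \<Rightarrow> nat \<Rightarrow> nat" where
  "frame tag x y = prod_encode (tag, prod_encode (x, y))"

abbreviation run_frame :: "nat \<Rightarrow> nat" where
  "run_frame e \<equiv> frame 0 e 0"

text \<open>
  The case distinction inverts \<^const>\<open>goedel\<close>: a code \<open>e \<ge> 4\<close> is \<open>4 * c + 4 + i\<close>, where \<open>i = e mod 4\<close>
  determines the constructor and \<open>c = (e - 4) div 4\<close> codes its arguments.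
\<close>

definition run_step :: "nat \<Rightarrow> nat \<Rightarrow> nat \<Rightarrow> nat" where
  "run_step e T v =
     (if e = 0 then prod_encode (T, 0)
      else if e = 1 then prod_encode (T, Suc v)
      else if e = 2 then prod_encode (T, pfst v)
      else if e = 3 then prod_encode (T, psnd v)
      else if e mod 4 = 0 then
        prod_encode (push (run_frame (pfst ((e - 4) div 4))) (push (frame 1 (psnd ((e - 4) div 4)) v) T), v)
      else if e mod 4 = 1 then
        prod_encode (push (run_frame (psnd ((e - 4) div 4))) (push (run_frame (pfst ((e - 4) div 4))) T), v)
      else if e mod 4 = 2 then
        prod_encode (push (run_frame (pfst ((e - 4) div 4)))
          (push (frame 3 (psnd ((e - 4) div 4)) (prod_encode (pfst v, prod_encode (0, psnd v)))) T), pfst v)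
      else prod_encode (push (run_frame ((e - 4) div 4))
          (push (frame 4 ((e - 4) div 4) (prod_encode (v, 0))) T), prod_encode (v, 0)))"

text \<open>
  The third part of a frame holds what its continuation must remember: for tag \<open>3\<close> the
  parameter, the number \<open>i\<close> of the stage whose value has been awaited, and the bound; for tag
  \<open>4\<close> the argument and the candidate that has been tested.
\<close>

definition frame_step :: "nat \<Rightarrow> nat \<Rightarrow> nat \<Rightarrow> nat \<Rightarrow> nat \<Rightarrow> nat" where
  "frame_step tag x y T v =
     (if tag = 0 then run_step x T v
      else if tag = 1 then prod_encode (push (run_frame x) (push (frame 2 v 0) T), y)
      else if tag = 2 then prod_encode (T, prod_encode (x, v))
      else if tag = 3 then
        if pfst (psnd y) = psnd (psnd y) then prod_encode (T, v)
        else prod_encode (push (run_frame x)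
          (push (frame 3 x (prod_encode (pfst y, prod_encode (Suc (pfst (psnd y)), psnd (psnd y))))) T),
          prod_encode (pfst y, prod_encode (pfst (psnd y), v)))
      else
        if v = 0 then prod_encode (T, psnd y)
        else prod_encode (push (run_frame x)
          (push (frame 4 x (prod_encode (pfst y, Suc (psnd y)))) T),
          prod_encode (pfst y, Suc (psnd y))))"

text \<open>
  Since a halted state, one with empty stack, is left unchanged, the result of a run can be read
  off at every later stage.
\<close>

definition step :: "nat \<Rightarrow> nat" where
  "step s = (if pfst s = 0 then s
     else frame_step (pfst (pfst (pfst s - 1))) (pfst (psnd (pfst (pfst s - 1))))
       (psnd (psnd (pfst (pfst s - 1)))) (psnd (pfst s - 1)) (psnd s))"

definition reaches :: "nat \<Rightarrow> nat \<Rightarrow> bool" where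
  "reaches s s' \<longleftrightarrow> (\<exists>t. (step ^^ t) s = s')"

lemma reaches_trans [trans]: assumes "reaches s s'" "reaches s' s''" shows "reaches s s''"
proof -
  obtain t t' where "(step ^^ t) s = s'" "(step ^^ t') s' = s''"
    using assms unfolding reaches_def by blast
  then have "(step ^^ (t' + t)) s = s''" by (simp add: funpow_add)
  then show ?thesis unfolding reaches_def by blast
qed

lemma reaches_step: "reaches s (step s)"
  unfolding reaches_def by (rule exI[of _ 1]) simp

lemma step_push [simp]:
  "step (prod_encode (push (frame tag x y) T, v)) = frame_step tag x y T v"
  by (simp add: step_def push_def frame_def)

lemma frame_step_simps [simp]:
  "frame_step 0 x y T v = run_step x T v"
  "frame_step (Suc 0) x y T v = prod_encode (push (run_frame x) (push (frame 2 v 0) T), y)"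
  "frame_step 2 x y T v = prod_encode (T, prod_encode (x, v))"
  "frame_step 3 x (prod_encode (a, prod_encode (i, k))) T v =
    (if i = k then prod_encode (T, v)
     else prod_encode (push (run_frame x)
       (push (frame 3 x (prod_encode (a, prod_encode (Suc i, k)))) T), prod_encode (a, prod_encode (i, v))))"
  "frame_step 4 x (prod_encode (a, k)) T v =
    (if v = 0 then prod_encode (T, k)
     else prod_encode (push (run_frame x)
       (push (frame 4 x (prod_encode (a, Suc k))) T), prod_encode (a, Suc k)))"
  by (simp_all add: frame_step_def)

lemma run_step_simps [simp]:
  "run_step 0 T v = prod_encode (T, 0)"
  "run_step (Suc 0) T v = prod_encode (T, Suc v)"
  "run_step 2 T v = prod_encode (T, pfst v)"
  "run_step 3 T v = prod_encode (T, psnd v)"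
  "run_step (4 * prod_encode (f, g) + 4) T v =
    prod_encode (push (run_frame f) (push (frame 1 g v) T), v)"
  "run_step (4 * prod_encode (f, g) + 5) T v =
    prod_encode (push (run_frame g) (push (run_frame f) T), v)"
  "run_step (4 * prod_encode (f, g) + 6) T v = prod_encode (push (run_frame f)
    (push (frame 3 g (prod_encode (pfst v, prod_encode (0, psnd v)))) T), pfst v)"
  "run_step (4 * f + 7) T v = prod_encode (push (run_frame f)
    (push (frame 4 f (prod_encode (v, 0))) T), prod_encode (v, 0))"
proof -
  have "(4 * c + 4) mod 4 = 0" "(4 * c + 5) mod 4 = 1" "(4 * c + 6) mod 4 = 2" "(4 * c + 7) mod 4 = 3"
    "(4 * c + 4 - 4) div 4 = c" "(4 * c + 5 - 4) div 4 = c" "(4 * c + 6 - 4) div 4 = c"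
    "(4 * c + 7 - 4) div 4 = c" for c :: nat
    by presburger+
  note arith = this
  show
    "run_step 0 T v = prod_encode (T, 0)"
    "run_step (Suc 0) T v = prod_encode (T, Suc v)"
    "run_step 2 T v = prod_encode (T, pfst v)"
    "run_step 3 T v = prod_encode (T, psnd v)"
    by (simp_all add: run_step_def)
  show "run_step (4 * prod_encode (f, g) + 4) T v =
      prod_encode (push (run_frame f) (push (frame 1 g v) T), v)"
    unfolding run_step_def arith by simp
  show "run_step (4 * prod_encode (f, g) + 5) T v =
      prod_encode (push (run_frame g) (push (run_frame f) T), v)"
    unfolding run_step_def arith by simp
  show "run_step (4 * prod_encode (f, g) + 6) T v = prod_encode (push (run_frame f)
      (push (frame 3 g (prod_encode (pfst v, prod_encode (0, psnd v)))) T), pfst v)"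
    unfolding run_step_def arith by simp
  show "run_step (4 * f + 7) T v = prod_encode (push (run_frame f)
      (push (frame 4 f (prod_encode (v, 0))) T), prod_encode (v, 0))"
    unfolding run_step_def arith by simp
qed

text \<open>
  The stack \<open>T\<close> below the topmost frame is arbitrary, for the induction has to apply to programs
  that run on top of continuations.
\<close>

lemma reaches_exec:
  "exec P n = Some v \<Longrightarrow>
    reaches (prod_encode (push (run_frame (goedel P)) T, n)) (prod_encode (T, v))"
proof (induction P arbitrary: n v T)
  case PZero
  then show ?case using reaches_step[of "prod_encode (push (run_frame 0) T, n)"] by simp
next
  case PSucc
  then show ?case using reaches_step[of "prod_encode (push (run_frame 1) T, n)"] by simp
next
  case PFst
  then show ?case using reaches_step[of "prod_encode (push (run_frame 2) T, n)"] by simp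
next
  case PSnd
  then show ?case using reaches_step[of "prod_encode (push (run_frame 3) T, n)"] by simp
next
  case (PPair P Q)
  then obtain a b where ab: "exec P n = Some a" "exec Q n = Some b" "v = prod_encode (a, b)"
    by (auto simp: bind_eq_Some_conv)
  let ?K = "push (frame 1 (goedel Q) n) T" and ?L = "push (frame 2 a 0) T"
  have "reaches (prod_encode (push (run_frame (goedel (PPair P Q))) T, n))
      (prod_encode (push (run_frame (goedel P)) ?K, n))"
    using reaches_step[of "prod_encode (push (run_frame (goedel (PPair P Q))) T, n)"] by simp
  also have "reaches \<dots> (prod_encode (?K, a))" by (rule PPair.IH(1)[OF ab(1)])
  also have "reaches \<dots> (prod_encode (push (run_frame (goedel Q)) ?L, n))"
    using reaches_step[of "prod_encode (?K, a)"] by simp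
  also have "reaches \<dots> (prod_encode (?L, b))" by (rule PPair.IH(2)[OF ab(2)])
  also have "reaches \<dots> (prod_encode (T, v))"
    using reaches_step[of "prod_encode (?L, b)"] ab(3) by simp
  finally show ?case .
next
  case (PComp P Q)
  then obtain a where a: "exec Q n = Some a" "exec P a = Some v"
    by (auto simp: bind_eq_Some_conv)
  have "reaches (prod_encode (push (run_frame (goedel (PComp P Q))) T, n))
      (prod_encode (push (run_frame (goedel Q)) (push (run_frame (goedel P)) T), n))"
    using reaches_step[of "prod_encode (push (run_frame (goedel (PComp P Q))) T, n)"] by simp
  also have "reaches \<dots> (prod_encode (push (run_frame (goedel P)) T, a))"
    by (rule PComp.IH(2)[OF a(1)])
  also have "reaches \<dots> (prod_encode (T, v))" by (rule PComp.IH(1)[OF a(2)])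
  finally show ?case .
next
  case (PPrec P Q)
  define a k where "a = pfst n" and "k = psnd n"
  define r where "r = rec_nat (exec P a)
    (\<lambda>i r. do { v \<leftarrow> r; exec Q (prod_encode (a, prod_encode (i, v))) })"
  have r0: "r 0 = exec P a" and rS: "r (Suc i) = do { v \<leftarrow> r i; exec Q (prod_encode (a, prod_encode (i, v))) }"
    for i by (simp_all add: r_def)
  have rk: "r k = Some v" using PPrec.prems by (simp add: r_def a_def k_def Let_def)
  let ?s = "prod_encode (push (run_frame (goedel (PPrec P Q))) T, n)"
  let ?K = "\<lambda>i. push (frame 3 (goedel Q) (prod_encode (a, prod_encode (i, k)))) T"
  have "reaches ?s (prod_encode (?K i, w))" if "r i = Some w" "i \<le> k" for i w
    using that
  proof (induction i arbitrary: w)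
    case 0
    have "reaches ?s (prod_encode (push (run_frame (goedel P)) (?K 0), a))"
      using reaches_step[of ?s] by (simp add: a_def k_def)
    also have "reaches \<dots> (prod_encode (?K 0, w))"
      using 0 by (intro PPrec.IH(1)) (simp add: r0)
    finally show ?case .
  next
    case (Suc i)
    then obtain u where u: "r i = Some u" "exec Q (prod_encode (a, prod_encode (i, u))) = Some w"
      by (auto simp: rS bind_eq_Some_conv)
    have "reaches ?s (prod_encode (?K i, u))" using Suc u by simp
    also have "reaches \<dots> (prod_encode (push (run_frame (goedel Q)) (?K (Suc i)),
        prod_encode (a, prod_encode (i, u))))"
      using reaches_step[of "prod_encode (?K i, u)"] Suc.prems(2) by simp
    also have "reaches \<dots> (prod_encode (?K (Suc i), w))"
      by (rule PPrec.IH(2)[OF u(2)])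
    finally show ?case .
  qed
  from this[OF rk order_refl]
  have "reaches ?s (prod_encode (?K k, v))" .
  also have "reaches \<dots> (prod_encode (T, v))"
    using reaches_step[of "prod_encode (?K k, v)"] by simp
  finally show ?case .
next
  case (PMu P)
  obtain k where k: "exec P (prod_encode (n, k)) = Some 0"
      "\<And>j. j < k \<Longrightarrow> exec P (prod_encode (n, j)) \<noteq> None"
      and v: "v = (LEAST k. exec P (prod_encode (n, k)) = Some 0)"
    using PMu.prems by (auto split: if_splits)
  have zero: "exec P (prod_encode (n, v)) = Some 0" unfolding v using k(1) by (rule LeastI)
  have "v \<le> k" unfolding v using k(1) by (rule Least_le)
  let ?s = "prod_encode (push (run_frame (goedel (PMu P))) T, n)"
  let ?K = "\<lambda>i. push (frame 4 (goedel P) (prod_encode (n, i))) T"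
  have "reaches ?s (prod_encode (push (run_frame (goedel P)) (?K i), prod_encode (n, i)))"
    if "i \<le> v" for i
    using that
  proof (induction i)
    case 0
    show ?case using reaches_step[of ?s] by simp
  next
    case (Suc i)
    obtain w where w: "exec P (prod_encode (n, i)) = Some w"
      using k(2)[of i] Suc.prems \<open>v \<le> k\<close> by auto
    have "w \<noteq> 0" using not_less_Least[of i "\<lambda>k. exec P (prod_encode (n, k)) = Some 0"] w Suc.prems
      unfolding v by auto
    have "reaches ?s (prod_encode (push (run_frame (goedel P)) (?K i), prod_encode (n, i)))"
      using Suc by simp
    also have "reaches \<dots> (prod_encode (?K i, w))" by (rule PMu.IH[OF w])
    also have
      "reaches \<dots> (prod_encode (push (run_frame (goedel P)) (?K (Suc i)), prod_encode (n, Suc i)))"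
      using reaches_step[of "prod_encode (?K i, w)"] \<open>w \<noteq> 0\<close> by simp
    finally show ?case .
  qed
  from this[OF order_refl]
  have "reaches ?s (prod_encode (push (run_frame (goedel P)) (?K v), prod_encode (n, v)))" .
  also have "reaches \<dots> (prod_encode (?K v, 0))" by (rule PMu.IH[OF zero])
  also have "reaches \<dots> (prod_encode (T, v))"
    using reaches_step[of "prod_encode (?K v, 0)"] by simp
  finally show ?case .
qed

lemma computable_step: "computable step"
  unfolding step_def frame_step_def run_step_def frame_def push_def
  by (intro computable.R_intros) simp_all

definition run :: "nat \<Rightarrow> nat \<Rightarrow> nat" where
  "run z t = (step ^^ t) (prod_encode (push (run_frame (pfst z)) 0, psnd z))"

lemma computable_run: "computable (\<lambda>c. run (pfst c) (psnd c))"
proof -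
  have eq: "(step ^^ t) s = rec_nat s (\<lambda>_ v. step v) t" for t s by (induction t) auto
  show ?thesis
    unfolding run_def eq frame_def push_def
    by (intro computable.R_intros computable.comp[OF computable_step])
qed

text \<open>
  Search for the first stage at which the machine has halted, and return the value found there.
  It is the result because a halted state no longer changes.
\<close>

lemma universal_prog: "\<exists>U. \<forall>e n v. phi e n = Some v \<longrightarrow> exec U (prod_encode (e, n)) = Some v"
proof -
  have "computable (\<lambda>c. pfst (run (pfst c) (psnd c)))" "computable (\<lambda>c. psnd (run (pfst c) (psnd c)))"
    by (intro computable.R_pfst computable.R_psnd computable_run)+
  then obtain P Q where P: "\<And>c. exec P c = Some (pfst (run (pfst c) (psnd c)))"
      and Q: "\<And>c. exec Q c = Some (psnd (run (pfst c) (psnd c)))"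
    unfolding computable_iff_prog by blast
  have "exec (PComp Q (PPair (PPair PFst PSnd) (PMu P))) (prod_encode (e, n)) = Some v"
    if "phi e n = Some v" for e n v
  proof -
    let ?z = "prod_encode (e, n)"
    have "goedel (inv goedel e) = e" by (rule surj_f_inv_f[OF surj_goedel])
    with reaches_exec[of "inv goedel e" n v 0] that
    obtain t where t: "run ?z t = prod_encode (0, v)"
      unfolding reaches_def run_def phi_def by auto
    define l where "l = (LEAST t. pfst (run ?z t) = 0)"
    have l: "pfst (run ?z l) = 0" "l \<le> t"
      unfolding l_def using t by (auto intro: LeastI[of _ t] Least_le)
    have stay: "run ?z (i + l) = run ?z l" for i
      by (induction i) (use l(1) in \<open>auto simp: run_def step_def\<close>)
    have "run ?z l = prod_encode (0, v)" using stay[of "t - l"] l(2) t by simp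
    moreover have "exec (PMu P) ?z = Some l" using l(1) by (auto simp: P l_def)
    ultimately show ?thesis by (simp add: Q del: exec.simps(8))
  qed
  then show ?thesis by blast
qed

primrec const_prog :: "nat \<Rightarrow> prog" where
  "const_prog 0 = PZero"
| "const_prog (Suc c) = PComp PSucc (const_prog c)"

lemma exec_const_prog [simp]: "exec (const_prog c) n = Some c"
  by (induction c) auto

definition specialise :: "prog \<Rightarrow> nat \<Rightarrow> prog" where
  "specialise P c = PComp P (PPair (const_prog c) (PPair PFst PSnd))"

lemma exec_specialise: "exec (specialise P c) n = exec P (prod_encode (c, n))"
  by (simp add: specialise_def)

text \<open>
  With \<open>exec_specialise\<close> this is the s-m-n theorem: an index of the specialised program is
  computed from the parameter, since the codes of the constant programs obey a recursion.
\<close>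

lemma computable_specialise: "computable (\<lambda>c. goedel (specialise P c))"
proof -
  have "goedel (const_prog c) = rec_nat 0 (\<lambda>_ v. 4 * prod_encode (1, v) + 5) c" for c
    by (induction c) auto
  then show ?thesis
    unfolding specialise_def goedel.simps by (simp only:) (intro computable.R_intros)
qed

lemma phi_goedel: "phi (goedel P) = exec P"
  unfolding phi_def by (simp add: inv_f_f[OF inj_goedel])

lemma range_phi: "range phi = range exec"
proof
  show "range phi \<subseteq> range exec" unfolding phi_def by blast
  show "range exec \<subseteq> range phi" using phi_goedel by (metis image_subsetI rangeI)
qed

text \<open>
  Most of the closure properties are constructors of programs, because tupling in \<open>K1\<close> is the
  pairing that programs use. The universal program \<open>U\<close> gives evaluation, and \<open>PMu U\<close> is the
  search for the first zero.
\<close>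

lemma effective_K1: "effective_coding K1"
proof
  have C: "realizable K1 = range exec" "tup K1 = (\<lambda>a b. prod_encode (a, b))" "tup1 K1 = pfst"
    "tup2 K1 = psnd" "nat_space K1 = Some"
    by (simp_all add: K1_def range_phi)
  have baire: "baire_space K1 e = Some x \<longleftrightarrow> (\<forall>n. phi e n = Some (x n))" for e x
  proof
    show "\<forall>n. phi e n = Some (x n)" if "baire_space K1 e = Some x"
      using that by (auto simp: K1_def split: if_splits)
    show "baire_space K1 e = Some x" if "\<forall>n. phi e n = Some (x n)"
      using that by (simp add: K1_def)
  qed
  obtain U where U: "\<And>e n v. phi e n = Some v \<Longrightarrow> exec U (prod_encode (e, n)) = Some v"
    using universal_prog by blast
  show "tup1 K1 (tup K1 a b) = a" "tup2 K1 (tup K1 a b) = b" "tup K1 (tup1 K1 c) (tup2 K1 c) = c"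
    for a b c by (rule tup_bij)+
  show "\<exists>H\<in>realizable K1. \<forall>p q r. G p = Some q \<longrightarrow> F q = Some r \<longrightarrow> H p = Some r"
    if FG: "F \<in> realizable K1" "G \<in> realizable K1" for F G
  proof -
    obtain P Q where "F = exec P" "G = exec Q" using FG unfolding C by blast
    then show ?thesis unfolding C by (intro bexI[of _ "exec (PComp P Q)"]) auto
  qed
  show "\<exists>H\<in>realizable K1. \<forall>p q r. F p = Some q \<longrightarrow> G p = Some r \<longrightarrow> H p = Some (tup K1 q r)"
    if FG: "F \<in> realizable K1" "G \<in> realizable K1" for F G
  proof -
    obtain P Q where "F = exec P" "G = exec Q" using FG unfolding C by blast
    then show ?thesis unfolding C by (intro bexI[of _ "exec (PPair P Q)"]) auto
  qed
  show "\<exists>F\<in>realizable K1. \<forall>p. F p = Some (tup1 K1 p)"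
    by (rule bexI[of _ "exec PFst"]) (auto simp: C)
  show "\<exists>F\<in>realizable K1. \<forall>p. F p = Some (tup2 K1 p)"
    by (rule bexI[of _ "exec PSnd"]) (auto simp: C)
  show "\<exists>F\<in>realizable K1. \<forall>p. \<exists>q. F p = Some q \<and> nat_space K1 q = Some k" for k
    by (rule bexI[of _ "exec (const_prog k)"]) (auto simp: C)
  show "morphism K1 (prod_space K1 (nat_space K1) (nat_space K1)) (nat_space K1) (\<lambda>z. h (prod_encode z))"
    if h: "computable h" for h
  proof -
    obtain P where "\<And>n. exec P n = Some (h n)" using h unfolding computable_iff_prog by blast
    then show ?thesis
      unfolding morphism_iff realizes_def
      by (intro bexI[of _ "exec P"]) (auto simp: C)
  qed
  show "\<exists>G\<in>realizable K1. \<forall>p g.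
      (\<forall>u k. nat_space K1 u = Some k \<longrightarrow> (\<exists>v. F (tup K1 p u) = Some v \<and> nat_space K1 v = Some (g k))) \<longrightarrow>
      (\<exists>q. G p = Some q \<and> baire_space K1 q = Some g)"
    if F: "F \<in> realizable K1" for F
  proof -
    obtain P where P: "F = exec P" using F unfolding C by blast
    obtain S where S: "\<And>c. exec S c = Some (goedel (specialise P c))"
      using computable_specialise unfolding computable_iff_prog by blast
    show ?thesis
      by (rule bexI[of _ "exec S"])
        (auto simp: C baire P S phi_goedel exec_specialise)
  qed
  show "morphism K1 (prod_space K1 (baire_space K1) (nat_space K1)) (nat_space K1) (\<lambda>z. fst z (snd z))"
    unfolding morphism_iff realizes_def
  proof (intro bexI[of _ "exec U"] allI impI)
    fix c z assume "prod_space K1 (baire_space K1) (nat_space K1) c = Some z"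
    then have "baire_space K1 (pfst c) = Some (fst z)" "psnd c = snd z"
      by (auto simp: C)
    moreover have "c = prod_encode (pfst c, psnd c)" by simp
    ultimately show "\<exists>q. exec U c = Some q \<and> nat_space K1 q = Some (fst z (snd z))"
      using U[of "pfst c" "psnd c"] by (metis C(5) baire)
  qed (simp add: C)
  show "morphism K1 (subspace (baire_space K1) {x. \<exists>k. x k = 0}) (nat_space K1) (\<lambda>x. LEAST k. x k = 0)"
    unfolding morphism_iff realizes_def
  proof (intro bexI[of _ "exec (PMu U)"] allI impI)
    fix e x assume "subspace (baire_space K1) {x. \<exists>k. x k = 0} e = Some x"
    then have "baire_space K1 e = Some x" and ex: "\<exists>k. x k = 0"
      by auto
    then have "exec U (prod_encode (e, k)) = Some (x k)" for k using U by (simp add: baire)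
    then show "\<exists>q. exec (PMu U) e = Some q \<and> nat_space K1 q = Some (LEAST k. x k = 0)"
      using ex by (simp add: C)
  qed (simp add: C)
qed

theorem theorem5p41:
  "complete_for K1 (baire_space K1) (\<lambda>A. Sigma02 K1 A \<and> unique_witness K1 A) (Fin K1) \<and>
   complete_for K2 (baire_space K2) (\<lambda>A. Sigma02 K2 A \<and> unique_witness K2 A) (Fin K2) \<and>
   complete_for KV (baire_space KV) (\<lambda>A. Sigma02 KV A \<and> unique_witness KV A) (Fin KV)"
  using effective_coding.Fin_complete[OF effective_K1] effective_coding.Fin_complete[OF effective_K2]
    effective_coding.Fin_complete[OF effective_KV] by blast

end
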